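(* For any negative discriminant $-d\equiv\pm1\pmod5$, the polynomial $p_{4d}(x)$ divides the resultant $\mathrm{Res}_y\big(P_2(y,x),p_d(y)\big)$, where $P_2(u,v)=(v+u^2)uv^2-(v-u^2)$.
   Context: $r(\tau)=q^{1/5}\prod_{m\ge1}(1-q^m)^{\left(\frac{m}{5}\right)}$ ($q=e^{2\pi i\tau}$) is the Rogers–Ramanujan continued fraction. For a negative discriminant $-D=d_Kf^2$ with $\left(\frac{-D}{5}\right)=+1$ ($d_K$ the discriminant of $K=\mathbb{Q}(\sqrt{-D})$, $R_K$ its ring of integers, $\wp_5$ a prime ideal of $R_K$ dividing $5$), $p_D(x)$ denotes the minimal polynomial over $\mathbb{Q}$ of $r(w_D/5)$, where $w_D=\frac{v+\sqrt{-D}}{2}\in R_K$ ($v\in\mathbb{Z}$), $\wp_5^2\mid w_D$ and $\gcd(N(w_D),f)=1$; this polynomial depends only on $D$. *)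

theory Defs
  imports
    "HOL-Analysis.Analysis"
    "HOL-Number_Theory.Number_Theory"
    "HOL-Algebra.Ideal_Product"
    "Subresultants.Resultant_Prelim"
begin

text \<open>The Rogers--Ramanujan continued fraction in its product form; the branch of
  \<open>q\<^sup>1\<^sup>/\<^sup>5\<close> is \<open>exp (2 \<pi> \<i> \<tau> / 5)\<close>.\<close>

definition rr_cf :: "complex \<Rightarrow> complex" where
  "rr_cf \<tau> = exp (2 * of_real pi * \<i> * \<tau> / 5) *
     (\<Prod>m. (1 - exp (2 * of_real pi * \<i> * \<tau>) ^ (m + 1)) powi Legendre (int (m + 1)) 5)"

text \<open>The minimal polynomial over the rationals, with the usual convention that it is \<open>0\<close>
  for a transcendental number.\<close>

definition min_poly_rat :: "complex \<Rightarrow> rat poly" where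
  "min_poly_rat x =
     (if algebraic x
      then THE p. lead_coeff p = 1 \<and> poly (map_poly of_rat p) x = 0 \<and>
             (\<forall>q. q \<noteq> 0 \<and> poly (map_poly of_rat q) x = 0 \<longrightarrow>
                  Polynomial.degree p \<le> Polynomial.degree q)
      else 0)"

definition negative_discriminant :: "int \<Rightarrow> bool" where
  "negative_discriminant \<Delta> \<longleftrightarrow> \<Delta> < 0 \<and> ([\<Delta> = 0] (mod 4) \<or> [\<Delta> = 1] (mod 4))"

text \<open>For \<open>D > 0\<close>: the root of \<open>- D\<close> in the upper half plane, and the field
  \<open>K\<close> it generates over the rationals.\<close>

definition sqrt_neg :: "int \<Rightarrow> complex" where
  "sqrt_neg D = \<i> * of_real (sqrt (of_int D))"

definition imag_quad_field :: "int \<Rightarrow> complex set" where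
  "imag_quad_field D = {of_rat a + of_rat b * sqrt_neg D | a b. True}"

definition ring_of_integers :: "int \<Rightarrow> complex ring" where
  "ring_of_integers D =
     \<lparr>carrier = {z \<in> imag_quad_field D. algebraic_int z},
      monoid.mult = (*), one = 1, ring.zero = 0, add = (+)\<rparr>"

definition integral_basis :: "int \<Rightarrow> complex \<Rightarrow> complex \<Rightarrow> bool" where
  "integral_basis D \<alpha> \<beta> \<longleftrightarrow>
     \<alpha> \<in> carrier (ring_of_integers D) \<and> \<beta> \<in> carrier (ring_of_integers D) \<and>
     (\<forall>z \<in> carrier (ring_of_integers D).
        \<exists>!ab :: int \<times> int. z = of_int (fst ab) * \<alpha> + of_int (snd ab) * \<beta>)"

text \<open>\<open>dK\<close> is the discriminant of \<open>K\<close>: the squared determinant of the conjugates of an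
  integral basis. The two embeddings of \<open>K\<close> are the inclusion and complex conjugation.\<close>

definition is_field_disc :: "int \<Rightarrow> int \<Rightarrow> bool" where
  "is_field_disc D dK \<longleftrightarrow>
     (\<exists>\<alpha> \<beta>. integral_basis D \<alpha> \<beta> \<and> of_int dK = (\<alpha> * cnj \<beta> - \<beta> * cnj \<alpha>)\<^sup>2)"

definition prime_ideal_above_5 :: "int \<Rightarrow> complex set \<Rightarrow> bool" where
  "prime_ideal_above_5 D P \<longleftrightarrow> primeideal P (ring_of_integers D) \<and> 5 \<in> P"

text \<open>\<open>w\<close> is an admissible choice of \<open>w\<^sub>D\<close>. Divisibility of an element by an ideal is
  membership; \<open>w * cnj w\<close> is the norm of \<open>w\<close>; \<open>f\<close> is the conductor, determined by
  \<open>- D = d\<^sub>K f\<^sup>2\<close>.\<close>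

definition admissible_w :: "int \<Rightarrow> complex \<Rightarrow> bool" where
  "admissible_w D w \<longleftrightarrow>
     w \<in> carrier (ring_of_integers D) \<and>
     (\<exists>v :: int. w = (of_int v + sqrt_neg D) / 2) \<and>
     (\<exists>P. prime_ideal_above_5 D P \<and> w \<in> ideal_prod (ring_of_integers D) P P) \<and>
     (\<exists>(dK :: int) (f :: int) (N :: int). is_field_disc D dK \<and> f > 0 \<and> - D = dK * f\<^sup>2 \<and>
        of_int N = w * cnj w \<and> gcd N f = 1)"

text \<open>\<open>p\<close> is the polynomial \<open>p\<^sub>D\<close>. It does not depend on the choice of \<open>w\<close>.\<close>

definition is_p :: "int \<Rightarrow> rat poly \<Rightarrow> bool" where
  "is_p D p \<longleftrightarrow> (\<exists>w. admissible_w D w \<and> p = min_poly_rat (rr_cf (w / 5)))"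

definition P2 :: "'a::comm_ring_1 \<Rightarrow> 'a \<Rightarrow> 'a" where
  "P2 u v = (v + u\<^sup>2) * u * v\<^sup>2 - (v - u\<^sup>2)"

text \<open>Polynomials in \<open>x\<close> and \<open>y\<close> are polynomials in \<open>y\<close> over \<open>rat poly\<close>, the
  coefficients being polynomials in \<open>x\<close>, so that \<open>resultant\<close> eliminates \<open>y\<close>.\<close>

definition X :: "rat poly poly" where "X = [:[:0, 1:]:]"
definition Y :: "rat poly poly" where "Y = [:0, 1:]"

definition poly_in_Y :: "rat poly \<Rightarrow> rat poly poly" where
  "poly_in_Y p = map_poly (\<lambda>c. [:c:]) p"

end

theory Submission
  imports Defs "HOL-Library.Nat_Bijection"
begin

text \<open>
  An element of \<open>\<wp>\<^sub>5\<^sup>2\<close> has norm divisible by \<open>25\<close>, so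
  \<open>w\<^sub>d = (v + \<surd>(-d)) / 2\<close> and \<open>w\<^sub>4\<^sub>d = u + \<surd>(-d)\<close> with \<open>u\<^sup>2 \<equiv> v\<^sup>2 \<equiv> -d\<close>, hence \<open>u \<equiv> \<plusminus>v\<close> modulo \<open>25\<close>.
  As \<open>r\<close> has period \<open>5\<close> and \<open>r (- cnj \<tau>) = cnj (r \<tau>)\<close> has the same minimal polynomial as \<open>r \<tau>\<close>,
  there is a \<open>\<tau>\<close> such that \<open>p\<^sub>d\<close> and \<open>p\<^sub>4\<^sub>d\<close> are the minimal polynomials of \<open>r \<tau>\<close> and \<open>r (2\<tau>)\<close>,
  and it remains to prove the modular equation \<open>P2 (r \<tau>) (r (2\<tau>)) = 0\<close>.

  Put \<open>[k] = \<Prod>\<^sub>i (1 - q\<^bsup>10i+k\<^esup>) (1 - q\<^bsup>10i+10-k\<^esup>)\<close> and let \<open>a, b, c, d, e\<close> now be \<open>[1], \<dots>, [5]\<close>. Then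
  \<open>r \<tau> = q\<^bsup>1/5\<^esup> a d / (b c)\<close>, \<open>r (2\<tau>) = q\<^bsup>2/5\<^esup> b / d\<close>, and the modular equation says
  \<open>b\<^sup>3 c\<^sup>2 (c d - q a b) = a\<^sup>2 d\<^sup>3 (c d + q a b)\<close>. This results from eliminating \<open>e\<close> from two instances
  of the three-term theta relation, \<open>e c b\<^sup>2 = a d (c d + q a b)\<close> and
  \<open>e a d\<^sup>2 = b c (c d - q a b)\<close>. The three-term relation follows from the Jacobi triple product.
\<close>

section \<open>Bilateral theta series\<close>

text \<open>Absolute convergence makes the product family summable on \<open>A \<times> B\<close>,
  so its sum may be computed iteratively.\<close>

lemma has_sum_times_abs_summable:
  fixes f :: "'a \<Rightarrow> complex" and g :: "'b \<Rightarrow> complex"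
  assumes f: "(\<lambda>x. norm (f x)) summable_on A" and g: "(\<lambda>y. norm (g y)) summable_on B"
  shows "((\<lambda>(x, y). f x * g y) has_sum (infsum f A * infsum g B)) (A \<times> B)"
proof (rule has_sum_SigmaI)
  fix x
  have "(g has_sum infsum g B) B"
    using abs_summable_summable[OF g] by simp
  from has_sum_cmult_right[OF this, of "f x"]
  show "((\<lambda>y. case (x, y) of (x, y) \<Rightarrow> f x * g y) has_sum f x * infsum g B) B"
    by simp
next
  have "(f has_sum infsum f A) A"
    using abs_summable_summable[OF f] by simp
  from has_sum_cmult_left[OF this, of "infsum g B"]
  show "((\<lambda>x. f x * infsum g B) has_sum infsum f A * infsum g B) A" .
next
  have "(\<lambda>xy. norm (case xy of (x, y) \<Rightarrow> f x * g y)) summable_on (A \<times> B)"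
    unfolding Infinite_Sum.abs_summable_on_Sigma_iff
  proof (intro conjI ballI)
    fix x
    show "(\<lambda>y. norm (case (x, y) of (x, y) \<Rightarrow> f x * g y)) summable_on B"
      using summable_on_cmult_right[OF g, of "norm (f x)"] by (simp add: norm_mult)
    have "(\<lambda>x. norm (norm (f x) * infsum (\<lambda>y. norm (g y)) B)) summable_on A"
      using summable_on_cmult_left[OF f] by (simp add: norm_mult infsum_nonneg)
    then show "(\<lambda>x. norm (\<Sum>\<^sub>\<infinity>y\<in>B. norm (case (x, y) of (x, y) \<Rightarrow> f x * g y))) summable_on A"
      by (simp add: norm_mult infsum_cmult_right')
  qed
  then show "(\<lambda>(x, y). f x * g y) summable_on A \<times> B"
    by (rule abs_summable_summable)
qed

text \<open>The general term of Jacobi's theta series, without the alternating sign: the triple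
  product concerns \<open>theta p (- z)\<close>. The division is exact, since n (n - 1) is
  even.\<close>

definition theta_term :: "complex \<Rightarrow> complex \<Rightarrow> int \<Rightarrow> complex" where
  "theta_term p z n = p powi (n * (n - 1) div 2) * z powi n"

definition theta :: "complex \<Rightarrow> complex \<Rightarrow> complex" where
  "theta p z = infsum (theta_term p z) UNIV"

lemma triangular_int_Suc: "(n + 1) * (n + 1 - 1) div 2 = n * (n - 1) div 2 + (n::int)"
proof -
  have "(n + 1) * (n + 1 - 1) = n * (n - 1) + n * 2"
    by (simp add: algebra_simps)
  then show ?thesis by (metis div_mult_self3 zero_neq_numeral add.commute)
qed

lemma theta_term_Suc:
  assumes "p \<noteq> 0" "z \<noteq> 0"
  shows "theta_term p z (n + 1) = theta_term p z n * (p powi n * z)"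
  unfolding theta_term_def triangular_int_Suc using assms
  by (simp add: power_int_add algebra_simps)

text \<open>The exponent n (n - 1) / 2 is invariant under n -> 1 - n, so questions about negative
  indices reduce to nonnegative ones at \<open>inverse z\<close>.\<close>

lemma theta_term_reflect:
  assumes "z \<noteq> 0"
  shows "theta_term p z (1 - n) = z * theta_term p (inverse z) n"
proof -
  have "(1 - n) * (1 - n - 1) = n * (n - 1)" by (simp add: algebra_simps)
  then show ?thesis using assms
    by (simp add: theta_term_def power_int_diff power_int_inverse field_simps)
qed

text \<open>Ratio test: the quotient of consecutive terms is \<open>p ^ n * z\<close>, which tends
  to 0.\<close>

lemma theta_term_summable_nat:
  assumes p: "p \<noteq> 0" "norm p < 1" and z: "z \<noteq> 0"
  shows "summable (\<lambda>n. norm (theta_term p z (int n)))"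
proof -
  have "(\<lambda>n. norm p ^ n * norm z) \<longlonglongrightarrow> 0 * norm z"
    using p by (intro tendsto_intros) (auto intro: LIMSEQ_power_zero)
  then have "eventually (\<lambda>n. norm p ^ n * norm z < 1 / 2) sequentially"
    by (rule order_tendstoD) simp
  then obtain N where N: "\<And>n. n \<ge> N \<Longrightarrow> norm p ^ n * norm z < 1 / 2"
    by (auto simp: eventually_sequentially)
  show ?thesis
  proof (rule summable_ratio_test)
    show "(1 / 2 :: real) < 1" by simp
    fix n assume n: "n \<ge> N"
    have "theta_term p z (int (Suc n)) = theta_term p z (int n) * (p ^ n * z)"
      using theta_term_Suc[OF p(1) z, of "int n"] by (simp add: add.commute)
    then have "norm (theta_term p z (int (Suc n))) = (norm p ^ n * norm z) * norm (theta_term p z (int n))"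
      by (simp add: norm_mult norm_power)
    also have "\<dots> \<le> 1 / 2 * norm (theta_term p z (int n))"
      using N[OF n] by (intro mult_right_mono) auto
    finally show "norm (norm (theta_term p z (int (Suc n)))) \<le> 1 / 2 * norm (norm (theta_term p z (int n)))"
      by simp
  qed
qed

lemma theta_term_abs_summable:
  assumes p: "p \<noteq> 0" "norm p < 1" and z: "z \<noteq> 0"
  shows "(\<lambda>n. norm (theta_term p z n)) summable_on UNIV"
proof -
  have nat: "(\<lambda>n. norm (theta_term p y n)) summable_on {0..}" if "y \<noteq> 0" for y
  proof -
    have "(\<lambda>n. norm (theta_term p y (int n))) summable_on UNIV"
      using theta_term_summable_nat[OF p that]
      by (intro norm_summable_imp_summable_on) simp
    then have "((\<lambda>n. norm (theta_term p y n)) \<circ> int) summable_on UNIV"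
      by (simp add: o_def)
    moreover have "range int = {0..}"
      by (auto simp: image_iff intro: nonneg_int_cases)
    ultimately show ?thesis
      using summable_on_reindex[of int UNIV "\<lambda>n. norm (theta_term p y n)"] by simp
  qed
  have "(\<lambda>n. norm (z * theta_term p (inverse z) n)) summable_on {0..}"
    using summable_on_cmult_right[OF nat[of "inverse z"], of "norm z"] z by (simp add: norm_mult)
  then have "(\<lambda>n. norm (theta_term p z (1 - n))) summable_on {0..}"
    using theta_term_reflect[OF z] by simp
  then have "((\<lambda>n. norm (theta_term p z n)) \<circ> (\<lambda>n. 1 - n)) summable_on {0..}"
    by (simp add: o_def)
  then have "(\<lambda>n. norm (theta_term p z n)) summable_on ((\<lambda>n. 1 - n) ` {0..})"
    by (subst summable_on_reindex) (auto simp: inj_on_def)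
  \<comment> \<open>The two halves overlap in 0 and 1, which is harmless for summability.\<close>
  then have "(\<lambda>n. norm (theta_term p z n)) summable_on ({0..} \<union> (\<lambda>n. 1 - n) ` {0..})"
    using nat[OF z] by (rule summable_on_union[rotated])
  moreover have "n \<in> {0..} \<union> (\<lambda>n. 1 - n) ` {0..}" for n :: int
    by (cases "n \<ge> 0") (auto intro!: image_eqI[of _ _ "1 - n"])
  then have "{0..} \<union> (\<lambda>n. 1 - n) ` {0..} = (UNIV :: int set)" by blast
  ultimately show ?thesis by simp
qed

lemma theta_term_square: "theta_term (p\<^sup>2) z n = p powi (n * (n - 1)) * z powi n"
proof -
  have "2 * (n * (n - 1) div 2) = n * (n - 1)" by simp
  then show ?thesis by (simp add: theta_term_def power_int_power)
qed

text \<open>The sign and the powers of x and y depend only on m + n and m - n, which suggests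
  summing over these two quantities.\<close>

lemma theta_term_mult:
  assumes p: "p \<noteq> 0" and x: "x \<noteq> 0" and y: "y \<noteq> 0"
  shows "theta_term p (- (x * y)) m * theta_term p (- (x / y)) n =
    (if even (m + n) then 1 else - 1) * p powi ((m * (m - 1) + n * (n - 1)) div 2) *
    x powi (m + n) * y powi (m - n)"
proof -
  have "m * (m - 1) div 2 + n * (n - 1) div 2 = (m * (m - 1) + n * (n - 1)) div 2"
    by (rule div_add[symmetric]) simp_all
  then have "p powi ((m * (m - 1) + n * (n - 1)) div 2) =
      p powi (m * (m - 1) div 2) * p powi (n * (n - 1) div 2)"
    using p by (simp flip: power_int_add)
  then show ?thesis using x y
    by (simp add: theta_term_def power_int_minus_left power_int_mult_distrib
        power_int_divide_distrib power_int_add power_int_diff)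
qed

text \<open>The double series splits by the parity of \<open>m + n\<close>. The antisymmetric shape of the right-hand
  side turns the three-term theta relations into Pluecker relations of \<open>2 \<times> 2\<close> minors.\<close>

lemma theta_mult_theta:
  assumes p: "p \<noteq> 0" "norm p < 1" and x: "x \<noteq> 0" and y: "y \<noteq> 0"
  shows "theta p (- (x * y)) * theta p (- (x / y)) =
    x * (x * theta (p\<^sup>2) (p\<^sup>2 * x\<^sup>2) * theta (p\<^sup>2) (p * y\<^sup>2) -
         theta (p\<^sup>2) (p * x\<^sup>2) * (y * theta (p\<^sup>2) (p\<^sup>2 * y\<^sup>2)))"
proof -
  define f where "f = (\<lambda>(m, n). theta_term p (- (x * y)) m * theta_term p (- (x / y)) n)"
  \<comment> \<open>\<open>E\<close> parametrises the pairs with m + n even, \<open>O'\<close> those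
    with m + n odd.\<close>
  define E where "E = (\<lambda>(s, t). (s + t, s - t :: int))"
  define O' where "O' = (\<lambda>(s, t). (s + t + 1, s - t :: int))"
  have p2: "p\<^sup>2 \<noteq> 0" "norm (p\<^sup>2) < 1"
    using p by (auto simp: norm_power power_less_one_iff)
  have f: "(f has_sum theta p (- (x * y)) * theta p (- (x / y))) UNIV"
    using has_sum_times_abs_summable[OF theta_term_abs_summable theta_term_abs_summable, of p "- (x * y)" p "- (x / y)"]
      p x y by (simp add: f_def theta_def)
  \<comment> \<open>Passing from the index s to s - 1 trades \<open>x\<^sup>2\<close> for
    \<open>p\<^sup>2 * x\<^sup>2\<close>, the form in which y occurs for the odd pairs. This shift
    produces the antisymmetry in x and y.\<close>
  have feven: "f (E (s, t)) = x\<^sup>2 * (theta_term (p\<^sup>2) (p\<^sup>2 * x\<^sup>2) (s - 1) * theta_term (p\<^sup>2) (p * y\<^sup>2) t)"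
    for s t
  proof -
    have "((s + t) * (s + t - 1) + (s - t) * (s - t - 1)) = (s * (s - 1) + t * t) * 2"
      by (simp add: algebra_simps)
    then have *: "((s + t) * (s + t - 1) + (s - t) * (s - t - 1)) div 2 = s * (s - 1) + t * t"
      by simp
    have "f (E (s, t)) = p powi (s * (s - 1) + t * t) * x powi (2 * s) * y powi (2 * t)"
      using theta_term_mult[OF p(1) x y, of "s + t" "s - t"] * by (simp add: f_def E_def)
    also have "s * (s - 1) + t * t = (s - 1) * (s - 1 - 1) + 2 * (s - 1) + (t * (t - 1) + t)"
      by (simp add: algebra_simps)
    also have "2 * s = 2 * (s - 1) + 2" by simp
    finally have "f (E (s, t)) = p powi ((s - 1) * (s - 1 - 1)) * p powi (2 * (s - 1)) *
        (p powi (t * (t - 1)) * p powi t) * (x powi (2 * (s - 1)) * x powi 2) * y powi (2 * t)"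
      using p x by (simp only: power_int_add disj_not1 simp_thms)
    then show ?thesis
      by (simp only: theta_term_square power_int_mult_distrib power_int_power power_int_numeral) simp
  qed
  have fodd: "f (O' (s, t)) = - (x * y) * (theta_term (p\<^sup>2) (p * x\<^sup>2) s * theta_term (p\<^sup>2) (p\<^sup>2 * y\<^sup>2) t)"
    for s t
  proof -
    have "((s + t + 1) * (s + t + 1 - 1) + (s - t) * (s - t - 1)) = (s * s + t * (t - 1) + 2 * t) * 2"
      by (simp add: algebra_simps)
    then have *: "((s + t + 1) * (s + t + 1 - 1) + (s - t) * (s - t - 1)) div 2 = s * (s - 1) + s + t * (t - 1) + 2 * t"
      by (simp add: algebra_simps)
    have "f (O' (s, t)) = - (p powi (s * (s - 1) + s + t * (t - 1) + 2 * t) * x powi (2 * s + 1) * y powi (2 * t + 1))"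
      using theta_term_mult[OF p(1) x y, of "s + t + 1" "s - t"] * by (simp add: f_def O'_def)
    then have "f (O' (s, t)) = - (p powi (s * (s - 1)) * p powi s * p powi (t * (t - 1)) * p powi (2 * t) *
        (x powi (2 * s) * x) * (y powi (2 * t) * y))"
      using p x y by (simp only: power_int_add power_int_1_right simp_thms)
    then show ?thesis
      by (simp only: theta_term_square power_int_mult_distrib power_int_power) simp
  qed
  have shift: "((\<lambda>s. norm (theta_term (p\<^sup>2) (p\<^sup>2 * x\<^sup>2) (s - 1))) summable_on UNIV) \<and>
      infsum (\<lambda>s. theta_term (p\<^sup>2) (p\<^sup>2 * x\<^sup>2) (s - 1)) UNIV = theta (p\<^sup>2) (p\<^sup>2 * x\<^sup>2)"
  proof -
    have b: "bij_betw (\<lambda>s. s - 1) UNIV (UNIV :: int set)"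
      by (rule bij_betw_byWitness[of _ "\<lambda>s. s + 1"]) auto
    show ?thesis
      using summable_on_reindex_bij_betw[OF b, of "\<lambda>s. norm (theta_term (p\<^sup>2) (p\<^sup>2 * x\<^sup>2) s)"]
        infsum_reindex_bij_betw[OF b, of "theta_term (p\<^sup>2) (p\<^sup>2 * x\<^sup>2)"]
        theta_term_abs_summable[OF p2, of "p\<^sup>2 * x\<^sup>2"] p x
      by (simp add: theta_def)
  qed
  have "((\<lambda>(s, t). theta_term (p\<^sup>2) (p\<^sup>2 * x\<^sup>2) (s - 1) * theta_term (p\<^sup>2) (p * y\<^sup>2) t) has_sum
      theta (p\<^sup>2) (p\<^sup>2 * x\<^sup>2) * theta (p\<^sup>2) (p * y\<^sup>2)) (UNIV \<times> UNIV)"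
    using has_sum_times_abs_summable[OF conjunct1[OF shift] theta_term_abs_summable, of "p\<^sup>2" "p * y\<^sup>2"] shift p2 p y
    by (simp add: theta_def)
  from has_sum_cmult_right[OF this, of "x\<^sup>2"]
  have "((f \<circ> E) has_sum x\<^sup>2 * (theta (p\<^sup>2) (p\<^sup>2 * x\<^sup>2) * theta (p\<^sup>2) (p * y\<^sup>2))) UNIV"
    by (simp add: o_def case_prod_unfold flip: feven)
  then have even: "(f has_sum x\<^sup>2 * (theta (p\<^sup>2) (p\<^sup>2 * x\<^sup>2) * theta (p\<^sup>2) (p * y\<^sup>2))) (range E)"
    by (subst has_sum_reindex) (auto simp: inj_on_def E_def)
  have "((\<lambda>(s, t). theta_term (p\<^sup>2) (p * x\<^sup>2) s * theta_term (p\<^sup>2) (p\<^sup>2 * y\<^sup>2) t) has_sum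
      theta (p\<^sup>2) (p * x\<^sup>2) * theta (p\<^sup>2) (p\<^sup>2 * y\<^sup>2)) (UNIV \<times> UNIV)"
    using has_sum_times_abs_summable[OF theta_term_abs_summable theta_term_abs_summable,
        of "p\<^sup>2" "p * x\<^sup>2" "p\<^sup>2" "p\<^sup>2 * y\<^sup>2"] p2 p x y
    by (simp add: theta_def)
  from has_sum_cmult_right[OF this, of "- (x * y)"]
  have "((f \<circ> O') has_sum - (x * y) * (theta (p\<^sup>2) (p * x\<^sup>2) * theta (p\<^sup>2) (p\<^sup>2 * y\<^sup>2))) UNIV"
    by (simp only: o_def case_prod_unfold UNIV_Times_UNIV flip: fodd) simp
  then have odd: "(f has_sum - (x * y) * (theta (p\<^sup>2) (p * x\<^sup>2) * theta (p\<^sup>2) (p\<^sup>2 * y\<^sup>2))) (range O')"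
    by (subst has_sum_reindex) (auto simp: inj_on_def O'_def)
  have "range E \<inter> range O' = {}"
    by (auto simp: E_def O'_def) presburger
  moreover have "mn \<in> range E \<union> range O'" for mn
  proof (cases mn)
    case (Pair m n)
    show ?thesis
    proof (cases "even (m + n)")
      case True
      then have "mn = E ((m + n) div 2, (m - n) div 2)"
        unfolding Pair E_def by (simp, presburger)
      then show ?thesis by blast
    next
      case False
      then have "mn = O' ((m + n - 1) div 2, (m - n - 1) div 2)"
        unfolding Pair O'_def by (simp, presburger)
      then show ?thesis by blast
    qed
  qed
  then have "range E \<union> range O' = UNIV" by blast
  ultimately have "(f has_sum x\<^sup>2 * (theta (p\<^sup>2) (p\<^sup>2 * x\<^sup>2) * theta (p\<^sup>2) (p * y\<^sup>2)) +
      - (x * y) * (theta (p\<^sup>2) (p * x\<^sup>2) * theta (p\<^sup>2) (p\<^sup>2 * y\<^sup>2))) UNIV"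
    using has_sum_Un_disjoint[OF even odd] by simp
  from has_sum_unique[OF f this] show ?thesis
    by (simp add: algebra_simps power2_eq_square)
qed

section \<open>Jacobi triple product\<close>

text \<open>The q-Pochhammer symbol \<open>(p; p)_n\<close>.\<close>

definition qpoch :: "complex \<Rightarrow> nat \<Rightarrow> complex" where
  "qpoch p n = (\<Prod>k<n. 1 - p ^ (k + 1))"

definition qpoch_inf :: "complex \<Rightarrow> complex" where
  "qpoch_inf p = (\<Prod>k. 1 - p ^ (k + 1))"

text \<open>Extending the reciprocal by \<open>0\<close> to negative indices makes the recurrence below hold on all
  of \<open>\<int>\<close>, so that sums with these coefficients need no boundary terms.\<close>

definition rqpoch :: "complex \<Rightarrow> int \<Rightarrow> complex" where
  "rqpoch p m = (if m < 0 then 0 else inverse (qpoch p (nat m)))"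

text \<open>For norm p < 1 this is the Gaussian binomial coefficient of 2N over N + n in base p; it
  vanishes for |n| > N.\<close>

definition jcoeff :: "complex \<Rightarrow> nat \<Rightarrow> int \<Rightarrow> complex" where
  "jcoeff p N n = qpoch p (2 * N) * rqpoch p (int N + n) * rqpoch p (int N - n)"

lemma one_minus_power_nonzero:
  fixes p :: complex
  assumes "norm p < 1" "n > 0"
  shows "1 - p ^ n \<noteq> 0"
proof
  assume "1 - p ^ n = 0"
  then have "norm p ^ n = 1" by (metis eq_iff_diff_eq_0 norm_one norm_power)
  then show False using assms by (metis power_less_one_iff norm_ge_zero less_irrefl)
qed

text \<open>At m = 0 the factor 1 - p^0 vanishes, in agreement with the value 0 at the index
  -1.\<close>

lemma rqpoch_rec:
  assumes "norm p < 1"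
  shows "rqpoch p (m - 1) = (1 - p powi m) * rqpoch p m"
proof (cases "m \<le> 0")
  case True
  then show ?thesis by (cases "m = 0") (auto simp: rqpoch_def)
next
  case False
  then obtain k where k: "m = int (Suc k)"
    by (metis gr0_implies_Suc not_le zero_less_imp_eq_int)
  have "p powi m = p ^ Suc k" unfolding k by (rule power_int_of_nat)
  then show ?thesis
    using one_minus_power_nonzero[OF assms, of "Suc k"] 
    by (simp add: rqpoch_def k qpoch_def nat_add_distrib)
qed

text \<open>Two Pascal steps at once. This is the recurrence that multiplication by (1 - z p^N) (1 -
  p^(N+1) / z) imposes on the coefficients of the theta terms.\<close>

lemma jcoeff_Suc:
  assumes p: "p \<noteq> 0" "norm p < 1"
  shows "jcoeff p (Suc N) n = (1 + p ^ (2 * N + 1)) * jcoeff p N n +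
    p ^ N * p powi (1 - n) * jcoeff p N (n - 1) + p ^ (N + 1) * p powi n * jcoeff p N (n + 1)"
proof -
  define s t where "s = p powi (int N + n)" and "t = p powi (int N - n)"
  \<comment> \<open>The other reciprocals are polynomial multiples of these two, which have the
    largest indices; the claim becomes a polynomial identity in p, s, t, x, y and
    \<open>qpoch p (2 * N)\<close>.\<close>
  define x y where "x = rqpoch p (int N + 1 + n)" and "y = rqpoch p (int N + 1 - n)"
  have s: "p powi (int N + 1 + n) = s * p" and t: "p powi (int N + 1 - n) = t * p"
    using p by (simp_all add: s_def t_def power_int_add power_int_diff)
  have r: "p ^ (2 * N + 1) = s * t * p"
  proof -
    have "s * t = p powi (int N + n + (int N - n))"
      using p by (simp only: s_def t_def power_int_add simp_thms)
    also have "\<dots> = p ^ (2 * N)" by (simp flip: of_nat_add add: mult_2)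
    finally show ?thesis by simp
  qed
  have x1: "rqpoch p (int N + n) = (1 - s * p) * x"
    using rqpoch_rec[OF p(2), of "int N + 1 + n"] by (simp add: s x_def)
  have x2: "rqpoch p (int N + (n - 1)) = (1 - s) * ((1 - s * p) * x)"
    using rqpoch_rec[OF p(2), of "int N + n"] by (simp add: s_def x1 add_diff_eq)
  have y1: "rqpoch p (int N - n) = (1 - t * p) * y"
    using rqpoch_rec[OF p(2), of "int N + 1 - n"] by (simp add: t y_def)
  have y2: "rqpoch p (int N - (n + 1)) = (1 - t) * ((1 - t * p) * y)"
    using rqpoch_rec[OF p(2), of "int N - n"] by (simp add: t_def y1 diff_diff_eq)
  have x0: "rqpoch p (int N + (n + 1)) = x" "rqpoch p (int N - (n - 1)) = y"
    "rqpoch p (int (Suc N) + n) = x" "rqpoch p (int (Suc N) - n) = y"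
    by (simp_all add: x_def y_def algebra_simps)
  have q: "qpoch p (2 * Suc N) = qpoch p (2 * N) * (1 - s * t * p) * (1 - s * t * p * p)"
  proof -
    have "qpoch p (2 * Suc N) = qpoch p (2 * N) * (1 - p ^ (2 * N + 1)) * (1 - p ^ (2 * N + 1) * p)"
      by (simp add: qpoch_def mult_ac)
    then show ?thesis unfolding r .
  qed
  have st: "p ^ N * p powi (1 - n) = t * p" "p ^ (N + 1) * p powi n = s * p"
    using p by (simp_all add: s_def t_def power_int_add power_int_diff)
  show ?thesis
    unfolding jcoeff_def x0 x1 x2 y1 y2 q st r by (simp add: algebra_simps)
qed

text \<open>Induction on N. The new factor expands to 1 + p^(2N+1) - z p^N - p^(N+1) / z, and
  multiplying a theta term by z or 1 / z moves its index by one, up to sign and a power of p. For N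
  = 0 only the index 0 contributes.\<close>

lemma finite_jacobi_triple_product:
  assumes p: "p \<noteq> 0" "norm p < 1" and z: "z \<noteq> 0"
  shows "((\<lambda>n. jcoeff p N n * theta_term p (- z) n) has_sum
    (\<Prod>k<N. (1 - z * p ^ k) * (1 - p ^ (k + 1) / z))) UNIV"
proof (induction N)
  case 0
  have "((\<lambda>n. jcoeff p 0 n * theta_term p (- z) n) has_sum 1) {0}"
    by (rule has_sum_finiteI) (auto simp: jcoeff_def rqpoch_def qpoch_def theta_term_def)
  moreover have "(((\<lambda>n. jcoeff p 0 n * theta_term p (- z) n) has_sum 1) {0}) =
    (((\<lambda>n. jcoeff p 0 n * theta_term p (- z) n) has_sum 1) UNIV)"
    by (rule has_sum_cong_neutral) (auto simp: jcoeff_def rqpoch_def)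
  ultimately show ?case by simp
next
  case (Suc N)
  let ?F = "\<Prod>k<N. (1 - z * p ^ k) * (1 - p ^ (k + 1) / z)"
  let ?f = "\<lambda>n. jcoeff p N n * theta_term p (- z) n"
  have b: "bij_betw (\<lambda>s. s - 1) UNIV (UNIV :: int set)" "bij_betw (\<lambda>s. s + 1) UNIV (UNIV :: int set)"
    by (rule bij_betw_byWitness[of _ "\<lambda>s. s + 1"], auto) (rule bij_betw_byWitness[of _ "\<lambda>s. s - 1"], auto)
  have shift: "((\<lambda>n. ?f (n - 1)) has_sum ?F) UNIV" "((\<lambda>n. ?f (n + 1)) has_sum ?F) UNIV"
    using has_sum_reindex_bij_betw[OF b(1), of ?f ?F] has_sum_reindex_bij_betw[OF b(2), of ?f ?F] Suc.IH
    by auto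
  have "((\<lambda>n. (1 + p ^ (2 * N + 1)) * ?f n + (- (p ^ N * z)) * ?f (n - 1) + (- (p ^ (N + 1) / z)) * ?f (n + 1))
      has_sum ((1 + p ^ (2 * N + 1)) * ?F + (- (p ^ N * z)) * ?F + (- (p ^ (N + 1) / z)) * ?F)) UNIV"
    by (intro has_sum_add has_sum_cmult_right Suc.IH shift)
  also have "((1 + p ^ (2 * N + 1)) * ?F + (- (p ^ N * z)) * ?F + (- (p ^ (N + 1) / z)) * ?F) =
      ?F * ((1 - z * p ^ N) * (1 - p ^ (N + 1) / z))"
  proof -
    have "(1 + p ^ (2 * N + 1)) + (- (p ^ N * z)) + (- (p ^ (N + 1) / z)) = (1 - z * p ^ N) * (1 - p ^ (N + 1) / z)"
      using z by (simp add: field_simps power_mult power2_eq_square)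
    then show ?thesis by (simp only: distrib_right[symmetric] mult.commute[of ?F])
  qed
  also have "(\<lambda>n. (1 + p ^ (2 * N + 1)) * ?f n + (- (p ^ N * z)) * ?f (n - 1) + (- (p ^ (N + 1) / z)) * ?f (n + 1)) =
      (\<lambda>n. jcoeff p (Suc N) n * theta_term p (- z) n)"
  proof
    fix n
    have "theta_term p (- z) n = theta_term p (- z) (n - 1) * (p powi (n - 1) * - z)"
      using theta_term_Suc[OF p(1), of "- z" "n - 1"] z by simp
    moreover have "p powi (n - 1) * p powi (1 - n) = 1"
      using p by (simp flip: power_int_add)
    ultimately have 1: "z * theta_term p (- z) (n - 1) = - (p powi (1 - n) * theta_term p (- z) n)"
      by (simp add: mult_ac)
    have 2: "theta_term p (- z) (n + 1) / z = - (p powi n * theta_term p (- z) n)"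
      using theta_term_Suc[OF p(1), of "- z" n] z by (simp add: mult_ac)
    have "jcoeff p (Suc N) n * theta_term p (- z) n = (1 + p ^ (2 * N + 1)) * ?f n
       + p ^ N * jcoeff p N (n - 1) * (p powi (1 - n) * theta_term p (- z) n)
       + p ^ (N + 1) * jcoeff p N (n + 1) * (p powi n * theta_term p (- z) n)"
      unfolding jcoeff_Suc[OF p] by (simp add: algebra_simps)
    also have "p powi (1 - n) * theta_term p (- z) n = - (z * theta_term p (- z) (n - 1))"
      using 1 by simp
    also have "p powi n * theta_term p (- z) n = - (theta_term p (- z) (n + 1) / z)"
      using 2 by simp
    finally show "(1 + p ^ (2 * N + 1)) * ?f n + (- (p ^ N * z)) * ?f (n - 1) + (- (p ^ (N + 1) / z)) * ?f (n + 1) =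
      jcoeff p (Suc N) n * theta_term p (- z) n"
      by (simp add: algebra_simps)
  qed
  finally show ?case by (simp add: mult.commute)
qed

lemma
  assumes "norm p < 1"
  shows qpoch_inf_nonzero: "qpoch_inf p \<noteq> 0"
    and qpoch_LIMSEQ: "qpoch p \<longlonglongrightarrow> qpoch_inf p"
proof -
  have "summable (\<lambda>k. norm (- (p ^ (k + 1))))"
    using assms by (simp add: norm_mult norm_power summable_geometric summable_mult)
  then have c: "convergent_prod (\<lambda>k. 1 - p ^ (k + 1))"
    using summable_imp_convergent_prod_complex[of "\<lambda>k. - (p ^ (k + 1))"]
      one_minus_power_nonzero[OF assms, of "Suc _"] by simp
  then show "qpoch_inf p \<noteq> 0"
    unfolding qpoch_inf_def using prodinf_nonzero[OF c] one_minus_power_nonzero[OF assms, of "Suc _"] by simp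
  show "qpoch p \<longlonglongrightarrow> qpoch_inf p"
    unfolding qpoch_inf_def qpoch_def
    using has_prod_imp_tendsto'[OF convergent_prod_has_prod[OF c]] by simp
qed

lemma rqpoch_LIMSEQ:
  assumes "norm p < 1"
  shows "(\<lambda>N. rqpoch p (int N + n)) \<longlonglongrightarrow> inverse (qpoch_inf p)"
proof -
  have "(\<lambda>N. inverse (qpoch p N)) \<longlonglongrightarrow> inverse (qpoch_inf p)"
    using qpoch_LIMSEQ[OF assms] qpoch_inf_nonzero[OF assms] by (rule tendsto_inverse)
  moreover have "filterlim (\<lambda>N. nat (int N + n)) at_top sequentially"
    unfolding filterlim_at_top
  proof (intro allI eventually_sequentiallyI)
    fix Z N assume "nat (int Z + \<bar>n\<bar>) \<le> N"
    then show "Z \<le> nat (int N + n)" by linarith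
  qed
  ultimately have "(\<lambda>N. inverse (qpoch p (nat (int N + n)))) \<longlonglongrightarrow> inverse (qpoch_inf p)"
    by (rule filterlim_compose)
  moreover have "eventually (\<lambda>N. inverse (qpoch p (nat (int N + n))) = rqpoch p (int N + n)) sequentially"
    by (rule eventually_sequentiallyI[of "nat (- n)"]) (auto simp: rqpoch_def)
  ultimately show ?thesis by (rule Lim_transform_eventually)
qed

lemma jcoeff_LIMSEQ:
  assumes "norm p < 1"
  shows "(\<lambda>N. jcoeff p N n) \<longlonglongrightarrow> inverse (qpoch_inf p)"
proof -
  have "(\<lambda>N. qpoch p (2 * N)) \<longlonglongrightarrow> qpoch_inf p"
    by (rule filterlim_compose[OF qpoch_LIMSEQ[OF assms]])
       (auto intro!: filterlim_subseq simp: strict_mono_def)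
  then have "(\<lambda>N. jcoeff p N n) \<longlonglongrightarrow> qpoch_inf p * inverse (qpoch_inf p) * inverse (qpoch_inf p)"
    using rqpoch_LIMSEQ[OF assms, of n] rqpoch_LIMSEQ[OF assms, of "- n"]
    unfolding jcoeff_def by (intro tendsto_mult) auto
  then show ?thesis using qpoch_inf_nonzero[OF assms] by simp
qed

text \<open>Convergent sequences are bounded, here \<open>qpoch p\<close> and its reciprocal. The
  bound is uniform in N and n and serves as majorant when N tends to infinity.\<close>

lemma jcoeff_bounded:
  assumes "norm p < 1"
  obtains M where "\<And>N n. norm (jcoeff p N n) \<le> M"
proof -
  obtain B where B: "\<And>n. norm (qpoch p n) \<le> B"
    using convergent_imp_Bseq[OF convergentI[OF qpoch_LIMSEQ[OF assms]]] by (auto simp: Bseq_def)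
  have "(\<lambda>N. inverse (qpoch p N)) \<longlonglongrightarrow> inverse (qpoch_inf p)"
    using qpoch_LIMSEQ[OF assms] qpoch_inf_nonzero[OF assms] by (rule tendsto_inverse)
  from convergent_imp_Bseq[OF convergentI[OF this]]
  obtain C where C: "C > 0" "\<And>n. norm (inverse (qpoch p n)) \<le> C"
    by (auto simp only: Bseq_def)
  have C': "norm (rqpoch p m) \<le> C" for m
    using C by (auto simp: rqpoch_def)
  have B0: "B \<ge> 0" using B[of 0] norm_ge_zero order_trans by blast
  show thesis
  proof
    fix N n
    show "norm (jcoeff p N n) \<le> B * C * C"
      unfolding jcoeff_def norm_mult using B C' C B0 by (intro mult_mono) auto
  qed
qed

text \<open>The limit of the finite form, with limit and sum exchanged by Tannery's theorem. The
  denominator \<open>qpoch_inf p\<close> accounts for the third factor 1 - p^(k+1), which is absent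
  from the product on the left.\<close>

theorem jacobi_triple_product:
  assumes p: "p \<noteq> 0" "norm p < 1" and z: "z \<noteq> 0"
  shows "(\<lambda>N. \<Prod>k<N. (1 - z * p ^ k) * (1 - p ^ (k + 1) / z)) \<longlonglongrightarrow> theta p (- z) / qpoch_inf p"
proof -
  \<comment> \<open>Tannery's theorem concerns series over the naturals, so the integers are
    enumerated by \<open>int_decode\<close>.\<close>
  define t where "t = (\<lambda>k. theta_term p (- z) (int_decode k))"
  obtain M where M: "\<And>N n. norm (jcoeff p N n) \<le> M"
    using jcoeff_bounded[OF p(2)] by blast
  have abs: "(\<lambda>n. norm (theta_term p (- z) n)) summable_on UNIV"
    using theta_term_abs_summable[OF p] z by simp
  have t: "t sums theta p (- z)"
  proof -
    have "(theta_term p (- z) has_sum theta p (- z)) UNIV"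
      unfolding theta_def by (rule has_sum_infsum[OF abs_summable_summable[OF abs]])
    then show ?thesis
      unfolding t_def using has_sum_reindex_bij_betw[OF bij_int_decode, of "theta_term p (- z)"]
      by (intro has_sum_imp_sums) simp
  qed
  have "(\<lambda>k. norm (t k)) summable_on UNIV"
    unfolding t_def using summable_on_reindex_bij_betw[OF bij_int_decode, of "\<lambda>n. norm (theta_term p (- z) n)"] abs
    by simp
  then have norm_t: "summable (\<lambda>k. M * norm (t k))"
    by (intro summable_mult summable_on_imp_summable)
  have "(\<lambda>N. \<Sum>k. jcoeff p N (int_decode k) * t k) \<longlonglongrightarrow> (\<Sum>k. inverse (qpoch_inf p) * t k)"
  proof (rule conjunct2[OF conjunct2[OF tannerys_theorem[OF _ _ norm_t]]])
    show "(\<lambda>N. jcoeff p N (int_decode k) * t k) \<longlonglongrightarrow> inverse (qpoch_inf p) * t k" for k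
      by (intro tendsto_intros jcoeff_LIMSEQ p)
    show "\<forall>\<^sub>F (k, N) in at_top \<times>\<^sub>F sequentially. norm (jcoeff p N (int_decode k) * t k) \<le> M * norm (t k)"
      using M by (intro always_eventually) (auto simp: norm_mult intro!: mult_right_mono)
  qed simp
  moreover have "(\<Sum>k. jcoeff p N (int_decode k) * t k) = (\<Prod>k<N. (1 - z * p ^ k) * (1 - p ^ (k + 1) / z))" for N
    using has_sum_reindex_bij_betw[OF bij_int_decode, of "\<lambda>n. jcoeff p N n * theta_term p (- z) n"]
      finite_jacobi_triple_product[OF p z, of N]
    by (intro sums_unique[symmetric] has_sum_imp_sums) (simp add: t_def)
  moreover have "(\<Sum>k. inverse (qpoch_inf p) * t k) = theta p (- z) / qpoch_inf p"
    using sums_unique[OF sums_mult[OF t, of "inverse (qpoch_inf p)"]] by (simp add: field_simps)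
  ultimately show ?thesis by simp
qed

section \<open>The modular equation of level two\<close>

text \<open>The case p = q^10, x = q^k, y = q^l of the product formula. As \<open>A\<close> and
  \<open>B\<close> depend on one index only, the bracket is the minor of columns k and l in a fixed
  matrix with two rows.\<close>

lemma theta_power_mult_theta_power:
  assumes "q \<noteq> 0" "norm q < 1" "l \<le> k"
  defines "A \<equiv> \<lambda>i. theta ((q ^ 10)\<^sup>2) (q ^ 10 * (q ^ i)\<^sup>2)"
    and "B \<equiv> \<lambda>i. q ^ i * theta ((q ^ 10)\<^sup>2) ((q ^ 10)\<^sup>2 * (q ^ i)\<^sup>2)"
  shows "theta (q ^ 10) (- (q ^ (k + l))) * theta (q ^ 10) (- (q ^ (k - l))) =
    q ^ k * (B k * A l - A k * B l)"
proof -
  have "q ^ 10 \<noteq> 0" "norm (q ^ 10) < 1"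
    using assms by (auto simp: norm_power power_less_one_iff)
  from theta_mult_theta[OF this, of "q ^ k" "q ^ l"] show ?thesis
    using assms by (simp add: A_def B_def power_add power_diff)
qed

text \<open>The Pluecker relations for the columns 0, 1, 2, 4 and 0, 2, 3, 4. The values
  \<open>t 6\<close> and \<open>t 7\<close> remain here; the symmetry k -> 10 - k is applied later,
  to the products.\<close>

lemma theta_level_10_relations:
  assumes q: "q \<noteq> 0" "norm q < 1"
  defines "t \<equiv> \<lambda>k. theta (q ^ 10) (- (q ^ k))"
  shows "t 5 * t 3 * t 2 ^ 2 = q * t 6 * t 2 * t 1 ^ 2 + t 4 ^ 2 * t 3 * t 1"
    and "t 4 ^ 2 * t 5 * t 1 = t 6 * t 2 * t 3 ^ 2 - q * t 7 * t 1 * t 2 ^ 2"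
proof -
  define A where "A = (\<lambda>i. theta ((q ^ 10)\<^sup>2) (q ^ 10 * (q ^ i)\<^sup>2))"
  define B where "B = (\<lambda>i. q ^ i * theta ((q ^ 10)\<^sup>2) ((q ^ 10)\<^sup>2 * (q ^ i)\<^sup>2))"
  define D where "D = (\<lambda>k l. B k * A l - A k * B l)"
  have D: "t (k + l) * t (k - l) = q ^ k * D k l" if "l \<le> k" for k l
    unfolding t_def D_def A_def B_def by (rule theta_power_mult_theta_power[OF q that])
  have plucker: "D i j * D k l - D i k * D j l + D i l * D j k = 0" for i j k l
    unfolding D_def by (simp add: algebra_simps)
  have 1: "t 1 * t 1 = q * D 1 0" "t 2 * t 2 = q ^ 2 * D 2 0" "t 4 * t 4 = q ^ 4 * D 4 0"
    "t 6 * t 2 = q ^ 4 * D 4 2" "t 5 * t 3 = q ^ 4 * D 4 1" "t 3 * t 1 = q ^ 2 * D 2 1"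
    "t 7 * t 1 = q ^ 4 * D 4 3" "t 3 * t 3 = q ^ 3 * D 3 0" "t 5 * t 1 = q ^ 3 * D 3 2"
    using D[of 0 1] D[of 0 2] D[of 0 4] D[of 2 4] D[of 1 4] D[of 1 2] D[of 3 4] D[of 0 3] D[of 2 3] 
    by simp_all
  have "t 5 * t 3 * t 2 ^ 2 = (t 5 * t 3) * (t 2 * t 2)"
    by (simp add: power2_eq_square)
  also have "\<dots> = q ^ 6 * (D 4 1 * D 2 0)" unfolding 1 by (simp add: algebra_simps flip: power_add)
  also have "D 4 1 * D 2 0 = D 4 2 * D 1 0 + D 4 0 * D 2 1"
    using plucker[of 4 2 1 0] by (simp add: algebra_simps)
  also have "q ^ 6 * \<dots> = q * (t 6 * t 2) * (t 1 * t 1) + (t 4 * t 4) * (t 3 * t 1)"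
    unfolding 1 by (simp add: algebra_simps eval_nat_numeral)
  finally show "t 5 * t 3 * t 2 ^ 2 = q * t 6 * t 2 * t 1 ^ 2 + t 4 ^ 2 * t 3 * t 1"
    by (simp add: power2_eq_square algebra_simps)
  have "t 4 ^ 2 * t 5 * t 1 = (t 4 * t 4) * (t 5 * t 1)"
    by (simp add: power2_eq_square)
  also have "\<dots> = q ^ 7 * (D 4 0 * D 3 2)" unfolding 1 by (simp add: algebra_simps flip: power_add)
  also have "D 4 0 * D 3 2 = D 4 2 * D 3 0 - D 4 3 * D 2 0"
    using plucker[of 4 3 2 0] by (simp add: algebra_simps)
  also have "q ^ 7 * \<dots> = (t 6 * t 2) * (t 3 * t 3) - q * (t 7 * t 1) * (t 2 * t 2)"
    unfolding 1 by (simp add: algebra_simps eval_nat_numeral)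
  finally show "t 4 ^ 2 * t 5 * t 1 = t 6 * t 2 * t 3 ^ 2 - q * t 7 * t 1 * t 2 ^ 2"
    by (simp add: power2_eq_square algebra_simps)
qed

section \<open>Infinite products over residue classes modulo 5 and 10\<close>

lemma convergent_prod_one_minus_power_If:
  fixes q :: complex
  assumes "norm q < 1"
  shows "convergent_prod (\<lambda>m. if m \<in> S then 1 - q ^ (m + 1) else 1)"
proof -
  have "summable (\<lambda>m. norm q ^ m)" using assms by simp
  then have "summable (\<lambda>m. norm (if m \<in> S then - (q ^ (m + 1)) else 0))"
  proof (rule summable_comparison_test'[where N = 0])
    fix m
    have "norm q * norm q ^ m \<le> 1 * norm q ^ m"
      using assms by (intro mult_right_mono) auto
    then show "norm (norm (if m \<in> S then - (q ^ (m + 1)) else 0)) \<le> norm q ^ m"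
      by (simp add: norm_mult norm_power)
  qed
  moreover have "(if m \<in> S then - (q ^ (m + 1)) else 0) \<noteq> - 1" for m
    using one_minus_power_nonzero[OF assms, of "m + 1"] by simp
  ultimately have "convergent_prod (\<lambda>m. 1 + (if m \<in> S then - (q ^ (m + 1)) else 0))"
    by (rule summable_imp_convergent_prod_complex)
  then show ?thesis
    by (rule back_subst[where P = convergent_prod]) auto
qed

lemma Legendre_5:
  "Legendre a 5 = (if a mod 5 = 0 then 0 else if a mod 5 \<in> {1, 4} then 1 else - 1)"
proof -
  have "QuadRes 5 a \<longleftrightarrow> a mod 5 \<in> {0, 1, 4}"
  proof
    assume "QuadRes 5 a"
    then obtain y where y: "y ^ 2 mod 5 = a mod 5" by (auto simp: QuadRes_def cong_def)
    have "y mod 5 \<in> {0, 1, 2, 3, 4}" by (simp, presburger)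
    moreover have "y ^ 2 mod 5 = (y mod 5) ^ 2 mod 5" by (simp add: power_mod)
    ultimately show "a mod 5 \<in> {0, 1, 4}" using y by auto
  next
    assume "a mod 5 \<in> {0, 1, 4}"
    then have "[0 ^ 2 = a] (mod 5) \<or> [1 ^ 2 = a] (mod 5) \<or> [2 ^ 2 = a] (mod 5)"
      by (auto simp: cong_def)
    then show "QuadRes 5 a" unfolding QuadRes_def by blast
  qed
  then show ?thesis by (auto simp: Legendre_def cong_def)
qed

definition rr_factor :: "complex \<Rightarrow> nat \<Rightarrow> complex" where
  "rr_factor q m = (1 - q ^ (m + 1)) powi Legendre (int (m + 1)) 5"

lemma rr_cf_altdef:
  "rr_cf \<tau> = exp (2 * of_real pi * \<i> * \<tau> / 5) * (\<Prod>m. rr_factor (exp (2 * of_real pi * \<i> * \<tau>)) m)"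
  by (simp add: rr_cf_def rr_factor_def)

text \<open>The product over the residues 1, 4 modulo 5 is divided by the one over 2, 3; both
  converge.\<close>

lemma convergent_prod_rr_factor:
  assumes "norm q < 1"
  shows "convergent_prod (rr_factor q)"
proof -
  let ?g = "\<lambda>S m. if m \<in> S then 1 - q ^ (m + 1) else 1"
  have "convergent_prod (\<lambda>m. ?g {m. int (m + 1) mod 5 \<in> {1, 4}} m / ?g {m. int (m + 1) mod 5 \<in> {2, 3}} m)"
    by (intro convergent_prod_divide convergent_prod_one_minus_power_If assms)
  also have "(\<lambda>m. ?g {m. int (m + 1) mod 5 \<in> {1, 4}} m / ?g {m. int (m + 1) mod 5 \<in> {2, 3}} m) = rr_factor q"
  proof
    fix m
    have "int (m + 1) mod 5 \<in> {0, 1, 2, 3, 4}" by (simp, presburger)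
    then show "?g {m. int (m + 1) mod 5 \<in> {1, 4}} m / ?g {m. int (m + 1) mod 5 \<in> {2, 3}} m = rr_factor q m"
      unfolding rr_factor_def Legendre_5 by (auto simp: power_int_minus field_simps)
  qed
  finally show ?thesis .
qed

lemma rr_factor_mod_5:
  "rr_factor q (5 * N + j) = (1 - q ^ (5 * N + (j + 1))) powi Legendre (int (j + 1)) 5"
proof -
  have "int (5 * N + j + 1) mod 5 = int (j + 1) mod 5"
    by (metis add.assoc mod_mult_self4 of_nat_add of_nat_mult of_nat_numeral)
  then show ?thesis by (simp add: rr_factor_def Legendre_5 add.assoc)
qed

text \<open>Blocks of five factors. The index m belongs to the exponent m + 1, so the last factor of
  each block has Legendre symbol 0 and equals 1.\<close>

lemma rr_factor_partial_prod:
  "(\<Prod>m<5 * N. rr_factor q m) =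
    (\<Prod>i<N. (1 - q ^ (5 * i + 1)) * (1 - q ^ (5 * i + 4)) / ((1 - q ^ (5 * i + 2)) * (1 - q ^ (5 * i + 3))))"
proof (induction N)
  case (Suc N)
  have "5 * Suc N = Suc (Suc (Suc (Suc (Suc (5 * N)))))" by simp
  then have "(\<Prod>m<5 * Suc N. rr_factor q m) = (\<Prod>m<5 * N. rr_factor q m) *
     (rr_factor q (5 * N) * rr_factor q (5 * N + 1) * rr_factor q (5 * N + 2) *
      rr_factor q (5 * N + 3) * rr_factor q (5 * N + 4))"
    by (simp add: numeral_eq_Suc mult.assoc)
  moreover have "rr_factor q (5 * N) = 1 - q ^ (5 * N + 1)" "rr_factor q (5 * N + 1) = inverse (1 - q ^ (5 * N + 2))"
     "rr_factor q (5 * N + 2) = inverse (1 - q ^ (5 * N + 3))" "rr_factor q (5 * N + 3) = 1 - q ^ (5 * N + 4)"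
     "rr_factor q (5 * N + 4) = 1"
    using rr_factor_mod_5[of q N 0] rr_factor_mod_5[of q N 1] rr_factor_mod_5[of q N 2]
      rr_factor_mod_5[of q N 3] rr_factor_mod_5[of q N 4]
    by (simp_all add: Legendre_5 power_int_minus del: power_Suc)
  ultimately have "(\<Prod>m<5 * Suc N. rr_factor q m) = (\<Prod>m<5 * N. rr_factor q m) *
      ((1 - q ^ (5 * N + 1)) * (1 - q ^ (5 * N + 4)) / ((1 - q ^ (5 * N + 2)) * (1 - q ^ (5 * N + 3))))"
    by (simp only: divide_inverse inverse_mult_distrib mult_ac mult_1)
  then show ?case by (simp only: Suc.IH prod.lessThan_Suc)
qed simp

lemma rr_factor_LIMSEQ:
  assumes "norm q < 1"
  shows "(\<lambda>N. \<Prod>i<N. (1 - q ^ (5 * i + 1)) * (1 - q ^ (5 * i + 4)) /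
      ((1 - q ^ (5 * i + 2)) * (1 - q ^ (5 * i + 3)))) \<longlonglongrightarrow> (\<Prod>m. rr_factor q m)"
proof -
  have "(\<lambda>n. \<Prod>m<n. rr_factor q m) \<longlonglongrightarrow> (\<Prod>m. rr_factor q m)"
    using has_prod_imp_tendsto'[OF convergent_prod_has_prod[OF convergent_prod_rr_factor[OF assms]]] .
  then have "(\<lambda>N. \<Prod>m<5 * N. rr_factor q m) \<longlonglongrightarrow> (\<Prod>m. rr_factor q m)"
    by (rule filterlim_compose) (auto intro!: filterlim_subseq simp: strict_mono_def)
  then show ?thesis unfolding rr_factor_partial_prod .
qed

text \<open>The partial products of [k] from the overview, meant for 0 < k < 10.\<close>

definition theta_prod :: "complex \<Rightarrow> nat \<Rightarrow> nat \<Rightarrow> complex" where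
  "theta_prod q k N = (\<Prod>i<N. (1 - q ^ (10 * i + k)) * (1 - q ^ (10 * i + (10 - k))))"

text \<open>The triple product in base q^10 at z = q^k.\<close>

lemma theta_prod_LIMSEQ:
  assumes q: "q \<noteq> 0" "norm q < 1" and k: "0 < k" "k < 10"
  shows "theta_prod q k \<longlonglongrightarrow> theta (q ^ 10) (- (q ^ k)) / qpoch_inf (q ^ 10)"
proof -
  have "q ^ 10 \<noteq> 0" "norm (q ^ 10) < 1" "q ^ k \<noteq> 0"
    using q by (auto simp: norm_power power_less_one_iff)
  from jacobi_triple_product[OF this] show ?thesis
    unfolding theta_prod_def
  proof (rule back_subst[where P = "\<lambda>f. f \<longlonglongrightarrow> _"], intro ext prod.cong refl)
    fix i
    have "(q ^ 10) ^ (i + 1) = q ^ (10 * i + (10 - k)) * q ^ k" "q ^ k * (q ^ 10) ^ i = q ^ (10 * i + k)"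
      using k by (simp_all add: add.commute flip: power_mult power_add)
    then show "(1 - q ^ k * (q ^ 10) ^ i) * (1 - (q ^ 10) ^ (i + 1) / q ^ k) =
      (1 - q ^ (10 * i + k)) * (1 - q ^ (10 * i + (10 - k)))"
      using q by simp
  qed
qed

text \<open>A convergent product of nonzero factors is nonzero. Through this lemma the theta values
  at level 10 are seen not to vanish, which is hard to read off from the series.\<close>

lemma theta_prod_limit_nonzero:
  assumes q: "norm q < 1" and k: "0 < k" "k < 10" and L: "theta_prod q k \<longlonglongrightarrow> L"
  shows "L \<noteq> 0"
proof -
  have c: "convergent_prod (\<lambda>i. 1 - q ^ (10 * i + j))" if "j > 0" for j
  proof -
    have "summable (\<lambda>i. norm q ^ i)" using q by simp
    then have "summable (\<lambda>i. norm (- (q ^ (10 * i + j))))"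
    proof (rule summable_comparison_test'[where N = 0])
      fix i
      show "norm (norm (- (q ^ (10 * i + j)))) \<le> norm q ^ i"
        using q by (simp add: norm_power power_decreasing)
    qed
    moreover have "- (q ^ (10 * i + j)) \<noteq> - 1" for i
      using one_minus_power_nonzero[OF q, of "10 * i + j"] that by simp
    ultimately have "convergent_prod (\<lambda>i. 1 + - (q ^ (10 * i + j)))"
      by (rule summable_imp_convergent_prod_complex)
    then show ?thesis by simp
  qed
  have cp: "convergent_prod (\<lambda>i. (1 - q ^ (10 * i + k)) * (1 - q ^ (10 * i + (10 - k))))"
    using k by (intro convergent_prod_mult c) auto
  have "theta_prod q k \<longlonglongrightarrow> (\<Prod>i. (1 - q ^ (10 * i + k)) * (1 - q ^ (10 * i + (10 - k))))"
    unfolding theta_prod_def using has_prod_imp_tendsto'[OF convergent_prod_has_prod[OF cp]] .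
  moreover have "(\<Prod>i. (1 - q ^ (10 * i + k)) * (1 - q ^ (10 * i + (10 - k)))) \<noteq> 0"
    using one_minus_power_nonzero[OF q] k by (intro prodinf_nonzero cp) auto
  ultimately show ?thesis using LIMSEQ_unique[OF L] by simp
qed

lemma prod_lessThan_double: "(\<Prod>i<2 * N. f i) = (\<Prod>i<N. f (2 * i) * f (2 * i + 1 :: nat) :: 'a :: comm_monoid_mult)"
  by (induction N) (simp_all add: mult.assoc)

text \<open>Modulo 10, the residues 1, 4 modulo 5 split into the pairs {1, 9} and {4, 6}, and 2, 3
  into {2, 8} and {3, 7}. Replacing q by its square doubles the exponents: 1, 4 become the pair {2,
  8} and 2, 3 become {4, 6}.\<close>

lemma prodinf_rr_factor_theta:
  assumes q: "q \<noteq> 0" "norm q < 1"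
  defines "L \<equiv> \<lambda>k. theta (q ^ 10) (- (q ^ k)) / qpoch_inf (q ^ 10)"
  shows "(\<Prod>m. rr_factor q m) = L 1 * L 4 / (L 2 * L 3)"
    and "(\<Prod>m. rr_factor (q\<^sup>2) m) = L 2 / L 4"
proof -
  have L: "theta_prod q k \<longlonglongrightarrow> L k" "L k \<noteq> 0" if "k \<in> {1, 2, 3, 4}" for k
  proof -
    show "theta_prod q k \<longlonglongrightarrow> L k"
      unfolding L_def using theta_prod_LIMSEQ[OF q, of k] that by auto
    then show "L k \<noteq> 0" by (rule theta_prod_limit_nonzero[OF q(2), rotated 2]) (use that in auto)
  qed
  let ?G = "\<lambda>q i. (1 - q ^ (5 * i + 1)) * (1 - q ^ (5 * i + 4)) / ((1 - q ^ (5 * i + 2)) * (1 - q ^ (5 * i + 3)))"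
  \<comment> \<open>Two blocks modulo 5 make one block modulo 10.\<close>
  have "(\<lambda>N. \<Prod>i<2 * N. ?G q i) \<longlonglongrightarrow> (\<Prod>m. rr_factor q m)"
    by (rule filterlim_compose[OF rr_factor_LIMSEQ[OF q(2)]])
      (auto intro!: filterlim_subseq simp: strict_mono_def)
  moreover have "(\<Prod>i<2 * N. ?G q i) = theta_prod q 1 N * theta_prod q 4 N / (theta_prod q 2 N * theta_prod q 3 N)" for N
    unfolding prod_lessThan_double theta_prod_def prod.distrib[symmetric] prod_dividef[symmetric]
    by (intro prod.cong refl) (simp add: add.commute mult_ac)
  moreover have "(\<lambda>N. theta_prod q 1 N * theta_prod q 4 N / (theta_prod q 2 N * theta_prod q 3 N)) \<longlonglongrightarrow> L 1 * L 4 / (L 2 * L 3)"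
    using L by (intro tendsto_intros) auto
  ultimately show "(\<Prod>m. rr_factor q m) = L 1 * L 4 / (L 2 * L 3)"
    using LIMSEQ_unique by simp
  have "norm (q\<^sup>2) < 1" using q by (simp add: norm_power power_less_one_iff)
  note rr_factor_LIMSEQ[OF this]
  moreover have "(\<Prod>i<N. ?G (q\<^sup>2) i) = theta_prod q 2 N / theta_prod q 4 N" for N
    unfolding theta_prod_def prod_dividef[symmetric]
  proof (intro prod.cong refl)
    fix i
    have "(q\<^sup>2) ^ (5 * i + 1) = q ^ (10 * i + 2)" "(q\<^sup>2) ^ (5 * i + 2) = q ^ (10 * i + 4)"
      "(q\<^sup>2) ^ (5 * i + 3) = q ^ (10 * i + 6)" "(q\<^sup>2) ^ (5 * i + 4) = q ^ (10 * i + 8)"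
      by (simp_all only: power_mult[symmetric] distrib_left) simp_all
    then show "?G (q\<^sup>2) i = (1 - q ^ (10 * i + 2)) * (1 - q ^ (10 * i + (10 - 2))) /
        ((1 - q ^ (10 * i + 4)) * (1 - q ^ (10 * i + (10 - 4))))"
      by simp
  qed
  moreover have "(\<lambda>N. theta_prod q 2 N / theta_prod q 4 N) \<longlonglongrightarrow> L 2 / L 4"
    using L by (intro tendsto_intros) auto
  ultimately show "(\<Prod>m. rr_factor (q\<^sup>2) m) = L 2 / L 4"
    using LIMSEQ_unique by simp
qed

lemma norm_exp_upper_half_plane: "Im \<tau> > 0 \<Longrightarrow> norm (exp (2 * of_real pi * \<i> * \<tau>)) < 1"
  by (simp add: norm_exp_eq_Re)

theorem P2_rr_cf:
  assumes "Im \<tau> > 0"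
  shows "P2 (rr_cf \<tau>) (rr_cf (2 * \<tau>)) = 0"
proof -
  define h where "h = exp (2 * of_real pi * \<i> * \<tau> / 5)"
  define q where "q = exp (2 * of_real pi * \<i> * \<tau>)"
  have q: "q \<noteq> 0" "norm q < 1"
    using norm_exp_upper_half_plane[OF assms] by (auto simp: q_def)
  have hq: "h ^ 5 = q" by (simp add: h_def q_def mult_ac flip: exp_of_nat_mult)
  have "exp (2 * of_real pi * \<i> * (2 * \<tau>) / 5) = h\<^sup>2" "exp (2 * of_real pi * \<i> * (2 * \<tau>)) = q\<^sup>2"
    by (simp_all add: h_def q_def mult_ac flip: exp_of_nat_mult)
  note rr = rr_cf_altdef[of \<tau>, folded h_def q_def] rr_cf_altdef[of "2 * \<tau>", unfolded this]
  define L where "L = (\<lambda>k. theta (q ^ 10) (- (q ^ k)) / qpoch_inf (q ^ 10))"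
  define a b c d e where "a = L 1" and "b = L 2" and "c = L 3" and "d = L 4" and "e = L 5"
  have L: "theta_prod q k \<longlonglongrightarrow> L k" if "0 < k" "k < 10" for k
    unfolding L_def using theta_prod_LIMSEQ[OF q that] .
  have nz: "a \<noteq> 0" "b \<noteq> 0" "c \<noteq> 0" "d \<noteq> 0" "h \<noteq> 0"
    unfolding a_def b_def c_def d_def h_def
    by (rule theta_prod_limit_nonzero[OF q(2) _ _ L]; simp)+ simp
  \<comment> \<open>The two factors of each term are swapped by k -> 10 - k, and equal sequences
    have equal limits.\<close>
  have "theta_prod q 6 = theta_prod q 4" "theta_prod q 7 = theta_prod q 3"
    by (simp_all add: theta_prod_def fun_eq_iff mult.commute)
  then have sym: "L 6 = d" "L 7 = c"
    using LIMSEQ_unique[of "theta_prod q 6", OF L] LIMSEQ_unique[of "theta_prod q 7", OF L] L[of 4] L[of 3]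
    unfolding c_def d_def by simp_all
  define Q where "Q = qpoch_inf (q ^ 10)"
  have Q: "Q \<noteq> 0"
    unfolding Q_def using q by (intro qpoch_inf_nonzero) (simp add: norm_power power_less_one_iff)
  have t: "theta (q ^ 10) (- (q ^ k)) = Q * L k" for k
    using Q by (simp add: L_def Q_def)
  \<comment> \<open>Both theta relations are homogeneous of degree four, so the common factor
    \<open>Q ^ 4\<close> cancels.\<close>
  have R: "e * c * b ^ 2 = q * d * b * a ^ 2 + d ^ 2 * c * a"
     "d ^ 2 * e * a = d * b * c ^ 2 - q * c * a * b ^ 2"
  proof -
    have "Q ^ 4 * (e * c * b ^ 2) = Q ^ 4 * (q * d * b * a ^ 2 + d ^ 2 * c * a)"
      using theta_level_10_relations(1)[OF q] unfolding t sym
      by (simp add: a_def b_def c_def d_def e_def algebra_simps eval_nat_numeral)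
    then show "e * c * b ^ 2 = q * d * b * a ^ 2 + d ^ 2 * c * a" using Q by simp
    have "Q ^ 4 * (d ^ 2 * e * a) = Q ^ 4 * (d * b * c ^ 2 - q * c * a * b ^ 2)"
      using theta_level_10_relations(2)[OF q] unfolding t sym
      by (simp add: a_def b_def c_def d_def e_def algebra_simps eval_nat_numeral)
    then show "d ^ 2 * e * a = d * b * c ^ 2 - q * c * a * b ^ 2" using Q by simp
  qed
  \<comment> \<open>Elimination of e: each relation is multiplied by the cofactor of e in the
    other.\<close>
  have "(d ^ 2 * a) * (e * c * b ^ 2) = (c * b ^ 2) * (d ^ 2 * e * a)"
    by (simp add: mult_ac)
  then have K: "b ^ 3 * c ^ 2 * (c * d - q * a * b) = a ^ 2 * d ^ 3 * (c * d + q * a * b)"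
    unfolding R by (simp add: algebra_simps eval_nat_numeral)
  have u: "rr_cf \<tau> = h * (a * d / (b * c))" and v: "rr_cf (2 * \<tau>) = h\<^sup>2 * (b / d)"
    using rr prodinf_rr_factor_theta[OF q] by (simp_all add: a_def b_def c_def d_def L_def)
  \<comment> \<open>The multiplier clears all denominators. Apart from the common factor
    \<open>h\<^sup>2\<close>, only \<open>h ^ 5\<close> remains, which is q.\<close>
  have "P2 (rr_cf \<tau>) (rr_cf (2 * \<tau>)) * (b ^ 2 * c ^ 3 * d ^ 2) =
      h\<^sup>2 * ((b ^ 3 * c ^ 2 + a ^ 2 * d ^ 3) * (h ^ 5 * a * b) - c * d * (b ^ 3 * c ^ 2 - a ^ 2 * d ^ 3))"
    unfolding P2_def u v using nz by (simp add: field_simps eval_nat_numeral)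
  also have "\<dots> = 0"
    unfolding hq using K by (simp add: algebra_simps)
  finally show ?thesis using nz by simp
qed

section \<open>Periodicity and complex conjugation of \<open>rr_cf\<close>\<close>

lemma rr_cf_shift: "rr_cf (\<tau> + 5 * of_int k) = rr_cf \<tau>"
proof -
  have "exp (2 * of_real pi * \<i> * (\<tau> + 5 * of_int k) / 5) = exp (2 * of_real pi * \<i> * \<tau> / 5 + 2 * of_int k * of_real pi * \<i>)"
    by (simp add: field_simps)
  also have "\<dots> = exp (2 * of_real pi * \<i> * \<tau> / 5)"
    by (metis (no_types, lifting) exp_plus_2pin mult.assoc mult.commute)
  finally have 1: "exp (2 * of_real pi * \<i> * (\<tau> + 5 * of_int k) / 5) = exp (2 * of_real pi * \<i> * \<tau> / 5)" .
  \<comment> \<open>q is the fifth power of the prefactor, so the period 5 of the prefactor carries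
    over to q.\<close>
  have "exp (2 * of_real pi * \<i> * t) = exp (2 * of_real pi * \<i> * t / 5) ^ 5" for t
    by (simp add: mult_ac flip: exp_of_nat_mult)
  then have "exp (2 * of_real pi * \<i> * (\<tau> + 5 * of_int k)) = exp (2 * of_real pi * \<i> * \<tau>)"
    using 1 by metis
  with 1 show ?thesis unfolding rr_cf_altdef by simp
qed

text \<open>The reflection conjugates q and its chosen fifth root, and the partial products are
  rational functions of q with rational coefficients.\<close>

lemma rr_cf_cnj:
  assumes "Im \<tau> > 0"
  shows "rr_cf (- cnj \<tau>) = cnj (rr_cf \<tau>)"
proof -
  define q where "q = exp (2 * of_real pi * \<i> * \<tau>)"
  have q: "norm q < 1" "norm (cnj q) < 1"
    using norm_exp_upper_half_plane[OF assms] by (auto simp: q_def)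
  have e: "exp (2 * of_real pi * \<i> * (- cnj \<tau>)) = cnj q"
     "exp (2 * of_real pi * \<i> * (- cnj \<tau>) / 5) = cnj (exp (2 * of_real pi * \<i> * \<tau> / 5))"
    by (simp_all add: q_def exp_cnj)
  have lim: "(\<lambda>n. \<Prod>m<n. rr_factor x m) \<longlonglongrightarrow> (\<Prod>m. rr_factor x m)" if "norm x < 1" for x
    using has_prod_imp_tendsto'[OF convergent_prod_has_prod[OF convergent_prod_rr_factor[OF that]]] .
  have "rr_factor (cnj q) m = cnj (rr_factor q m)" for m
    by (simp add: rr_factor_def power_int_def)
  then have "(\<lambda>n. \<Prod>m<n. rr_factor (cnj q) m) = (\<lambda>n. cnj (\<Prod>m<n. rr_factor q m))"
    by simp
  then have "(\<Prod>m. rr_factor (cnj q) m) = cnj (\<Prod>m. rr_factor q m)"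
    using lim[OF q(2)] tendsto_cnj[OF lim[OF q(1)]] LIMSEQ_unique by metis
  then show ?thesis unfolding rr_cf_altdef e by (simp add: q_def)
qed

section \<open>Minimal polynomials and resultants\<close>

lemma poly_eq_sum_lessThan:
  fixes x :: "'a :: comm_semiring_1"
  assumes "Polynomial.degree p < N"
  shows "poly p x = (\<Sum>k<N. Polynomial.coeff p k * x ^ k)"
  unfolding poly_altdef
  by (rule sum.mono_neutral_left) (use assms in \<open>auto simp: coeff_eq_0\<close>)

text \<open>The vector of powers of u, from u^(m+n-1) down to 1, lies in the kernel of the Sylvester
  matrix: each entry of the product is the value at u of a monomial multiple of p or q.\<close>

lemma resultant_eq_0_if_common_root:
  fixes p q :: "'a :: idom poly"
  assumes deg: "Polynomial.degree p > 0" and p: "poly p u = 0" and q: "poly q u = 0"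
  shows "resultant p q = 0"
proof -
  define m n where "m = Polynomial.degree p" and "n = Polynomial.degree q"
  define x where "x = vec (m + n) (\<lambda>j. u ^ (m + n - Suc j))"
  have sum0: "(\<Sum>j<m + n. Polynomial.coeff (Polynomial.monom 1 (Suc l) * f) (m + n - j) * u ^ (m + n - Suc j)) = 0"
    if "poly f u = 0" "l + Polynomial.degree f < m + n" for l and f :: "'a poly"
  proof -
    define g where "g = Polynomial.monom 1 l * f"
    \<comment> \<open>The index formula for the Sylvester matrix carries one extra power of the
      variable: coefficient m + n - j of the shifted polynomial is coefficient m + n - j - 1 of
      \<open>g\<close>.\<close>
    have g: "Polynomial.monom 1 (Suc l) * f = pCons 0 g" by (simp add: g_def monom_Suc)
    have "Polynomial.degree g \<le> l + Polynomial.degree f"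
      unfolding g_def by (metis (no_types, opaque_lifting) add_le_mono1 degree_monom_le degree_mult_le order_trans)
    then have "poly g u = (\<Sum>k<m + n. Polynomial.coeff g k * u ^ k)"
      using that by (intro poly_eq_sum_lessThan) simp
    also have "\<dots> = (\<Sum>j<m + n. Polynomial.coeff g (m + n - Suc j) * u ^ (m + n - Suc j))"
      by (rule sum.nat_diff_reindex[symmetric])
    also have "\<dots> = (\<Sum>j<m + n. Polynomial.coeff (pCons 0 g) (m + n - j) * u ^ (m + n - Suc j))"
      by (intro sum.cong refl) (auto simp: coeff_pCons split: nat.splits dest: arg_cong[of _ _ "\<lambda>k. k - 1"])
    finally show ?thesis using that(1) by (simp add: g) (simp add: g_def)
  qed
  have "sylvester_mat p q *\<^sub>v x = 0\<^sub>v (m + n)"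
  proof (rule eq_vecI)
    fix i assume "i < dim_vec (0\<^sub>v (m + n) :: 'a vec)"
    then have i: "i < m + n" by simp
    then have "(sylvester_mat p q *\<^sub>v x) $ i =
        (\<Sum>j<m + n. sylvester_mat p q $$ (i, j) * u ^ (m + n - Suc j))"
      by (simp add: x_def scalar_prod_def m_def n_def atLeast0LessThan)
    also have "\<dots> = 0"
    proof (cases "i < n")
      case True
      then have "(\<Sum>j<m + n. sylvester_mat p q $$ (i, j) * u ^ (m + n - Suc j)) =
         (\<Sum>j<m + n. Polynomial.coeff (Polynomial.monom 1 (Suc (n - Suc i)) * p) (m + n - j) * u ^ (m + n - Suc j))"
        using i by (intro sum.cong refl) (simp add: sylvester_index_mat2 m_def n_def Suc_diff_Suc)
      also have "\<dots> = 0" using True by (intro sum0 p) (simp add: m_def)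
      finally show ?thesis .
    next
      case False
      then have "(\<Sum>j<m + n. sylvester_mat p q $$ (i, j) * u ^ (m + n - Suc j)) =
         (\<Sum>j<m + n. Polynomial.coeff (Polynomial.monom 1 (Suc (m + n - Suc i)) * q) (m + n - j) * u ^ (m + n - Suc j))"
        using i by (intro sum.cong refl) (simp add: sylvester_index_mat2 m_def n_def Suc_diff_Suc)
      also have "\<dots> = 0" using False i by (intro sum0 q) (simp add: n_def)
      finally show ?thesis .
    qed
    finally show "(sylvester_mat p q *\<^sub>v x) $ i = (0\<^sub>v (m + n) :: 'a vec) $ i" using i by simp
  qed (simp add: m_def n_def)
  \<comment> \<open>The last entry of \<open>x\<close> is u^0 = 1, and it exists because p has
    positive degree.\<close>
  moreover have "x \<noteq> 0\<^sub>v (m + n)"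
  proof
    assume "x = 0\<^sub>v (m + n)"
    then have "x $ (m + n - 1) = 0\<^sub>v (m + n) $ (m + n - 1)" by simp
    then show False using deg by (simp add: x_def m_def)
  qed
  moreover have "x \<in> carrier_vec (m + n)" by (simp add: x_def)
  moreover have "sylvester_mat p q \<in> carrier_mat (m + n) (m + n)"
    by (simp add: m_def n_def sylvester_carrier_mat)
  ultimately show ?thesis
    unfolding resultant_def using det_0_iff_vec_prod_zero by blast
qed

section \<open>Minimal polynomials over the rationals\<close>

abbreviation poly_rat :: "rat poly \<Rightarrow> complex \<Rightarrow> complex" where
  "poly_rat p x \<equiv> poly (map_poly of_rat p) x"

interpretation of_rat_complex_poly_hom: map_poly_inj_idom_hom "of_rat :: rat \<Rightarrow> complex" ..

lemma poly_rat_cnj: "poly_rat p (cnj x) = cnj (poly_rat p x)"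
proof (rule poly_cnj_real[symmetric])
  have "(of_rat r :: complex) \<in> \<real>" for r
    by (cases r) (simp add: of_rat_rat)
  then show "Polynomial.coeff (map_poly of_rat p :: complex poly) n \<in> \<real>" for n
    by (simp add: coeff_map_poly)
qed

text \<open>A polynomial with rational coefficients vanishes at x exactly when it vanishes at
  \<open>cnj x\<close>.\<close>

lemma min_poly_rat_cnj: "min_poly_rat (cnj x) = min_poly_rat x"
  by (simp add: min_poly_rat_def poly_rat_cnj)

lemma poly_rat_0_imp_algebraic:
  assumes "p \<noteq> 0" "poly_rat p x = 0"
  shows "algebraic x"
  using assms by (intro algebraicI'[of "map_poly of_rat p"]) (auto simp: coeff_map_poly)

lemma monic_minimal_dvd:
  fixes p q :: "rat poly"
  assumes "lead_coeff p = 1" "poly_rat p x = 0"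
    and min: "\<And>q. q \<noteq> 0 \<Longrightarrow> poly_rat q x = 0 \<Longrightarrow> Polynomial.degree p \<le> Polynomial.degree q"
    and q: "poly_rat q x = 0"
  shows "p dvd q"
proof -
  have p0: "p \<noteq> 0" using assms(1) by auto
  have "poly_rat (q mod p) x = poly_rat (q - p * (q div p)) x"
    by (simp add: minus_mult_div_eq_mod)
  also have "\<dots> = 0" using assms by (simp add: hom_distribs)
  finally have "q mod p = 0"
    using min[of "q mod p"] degree_mod_less[OF p0, of q] by linarith
  then show ?thesis by auto
qed

text \<open>The definite description is well defined: a nonzero annihilating polynomial of least
  degree, made monic, exists, and two such polynomials divide each other.\<close>

lemma min_poly_rat_props:
  assumes "algebraic x"
  shows "lead_coeff (min_poly_rat x) = 1" "poly_rat (min_poly_rat x) x = 0"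
    "\<And>q. poly_rat q x = 0 \<Longrightarrow> min_poly_rat x dvd q"
proof -
  let ?P = "\<lambda>p. lead_coeff p = 1 \<and> poly_rat p x = 0 \<and>
     (\<forall>q. q \<noteq> 0 \<and> poly_rat q x = 0 \<longrightarrow> Polynomial.degree p \<le> Polynomial.degree q)"
  let ?Z = "\<lambda>p. p \<noteq> 0 \<and> poly_rat p x = 0"
  obtain p0 :: "int poly" where "p0 \<noteq> 0" "poly (map_poly of_int p0) x = 0"
    using assms by (rule algebraicE')
  then have "?Z (map_poly of_int p0)"
    by (simp add: map_poly_map_poly o_def map_poly_eq_0_iff)
  then obtain p where p: "?Z p" and min: "\<And>q. ?Z q \<Longrightarrow> Polynomial.degree p \<le> Polynomial.degree q"
    using ex_has_least_nat[of ?Z _ Polynomial.degree] by metis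
  define r where "r = Polynomial.smult (inverse (lead_coeff p)) p"
  have r: "?P r"
    using p min by (auto simp: r_def hom_distribs)
  have "s = r" if "?P s" for s
  proof -
    have "r dvd s" "s dvd r" using r that by (auto intro!: monic_minimal_dvd)
    then show ?thesis using r that by (metis poly_dvd_antisym)
  qed
  with r have "(THE p. ?P p) = r"
    by (intro the_equality)
  then have "min_poly_rat x = r"
    using assms by (simp add: min_poly_rat_def)
  with r show "lead_coeff (min_poly_rat x) = 1" "poly_rat (min_poly_rat x) x = 0"
     "\<And>q. poly_rat q x = 0 \<Longrightarrow> min_poly_rat x dvd q"
    by (auto intro!: monic_minimal_dvd)
qed

text \<open>At a transcendental number only q = 0 vanishes, and 0 divides 0; the default value 0
  makes the statement uniform in x.\<close>

lemma min_poly_rat_dvd: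
  assumes "poly_rat q x = 0"
  shows "min_poly_rat x dvd q"
proof (cases "algebraic x")
  case True
  then show ?thesis using min_poly_rat_props(3) assms by blast
next
  case False
  then have "q = 0" using poly_rat_0_imp_algebraic assms by blast
  then show ?thesis by simp
qed

lemma min_poly_rat_root: "poly_rat (min_poly_rat x) x = 0"
  by (cases "algebraic x") (simp_all add: min_poly_rat_props(2), simp add: min_poly_rat_def)

text \<open>As a polynomial in y this is a cubic with leading coefficient x^2.\<close>

lemma P2_Y_X: "P2 Y X = [:- [:0, 1:], [:0, 1:] ^ 3, 1, [:0, 1:] ^ 2:]"
  by (simp add: P2_def X_def Y_def power2_eq_square power3_eq_cube one_pCons)

text \<open>Evaluation at x = v commutes with the resultant because it preserves both degrees; for
  the cubic this uses v \<noteq> 0. The specialised polynomials have the common root u.\<close>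

lemma poly_rat_resultant_P2:
  assumes "P2 u v = 0" "v \<noteq> 0" "poly_rat p u = 0"
  shows "poly_rat (resultant (P2 Y X) (poly_in_Y p)) v = 0"
proof -
  define h where "h = (\<lambda>f. poly_rat f v)"
  interpret h: comm_ring_hom h
    by standard (simp_all add: h_def hom_distribs)
  have hX: "h [:0, 1:] = v" "h [:0, - 1:] = - v" by (simp_all add: h_def map_poly_pCons of_rat_minus)
  have P: "map_poly h (P2 Y X) = [:- v, v ^ 3, 1, v ^ 2:]"
    unfolding P2_Y_X by (simp add: map_poly_pCons hom_distribs hX)
  have p: "map_poly h (poly_in_Y p) = map_poly of_rat p"
  proof -
    have "h [:c:] = of_rat c" for c by (cases "c = 0") (simp_all add: h_def map_poly_pCons)
    then show ?thesis unfolding poly_in_Y_def by (simp add: map_poly_map_poly o_def)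
  qed
  have "h (resultant (P2 Y X) (poly_in_Y p)) = resultant (map_poly h (P2 Y X)) (map_poly h (poly_in_Y p))"
  proof (rule h.resultant_map_poly[symmetric])
    show "Polynomial.degree (map_poly h (P2 Y X)) = Polynomial.degree (P2 Y X)"
      unfolding P unfolding P2_Y_X using assms(2) by simp
    show "Polynomial.degree (map_poly h (poly_in_Y p)) = Polynomial.degree (poly_in_Y p)"
      unfolding p unfolding poly_in_Y_def by (simp add: degree_map_poly)
  qed
  also have "\<dots> = 0"
    unfolding P p
  proof (rule resultant_eq_0_if_common_root[OF _ _ assms(3)])
    show "poly [:- v, v ^ 3, 1, v ^ 2:] u = 0"
      using assms(1) by (simp add: P2_def algebra_simps power2_eq_square power3_eq_cube)
  qed (use assms(2) in simp)
  finally show ?thesis by (simp add: h_def)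
qed

lemma rr_cf_nonzero:
  assumes "Im \<tau> > 0"
  shows "rr_cf \<tau> \<noteq> 0"
proof -
  note q = norm_exp_upper_half_plane[OF assms]
  have "rr_factor (exp (2 * of_real pi * \<i> * \<tau>)) m \<noteq> 0" for m
    using one_minus_power_nonzero[OF q, of "m + 1"] by (simp add: rr_factor_def)
  then show ?thesis
    unfolding rr_cf_altdef using prodinf_nonzero[OF convergent_prod_rr_factor[OF q]] by simp
qed

lemma min_poly_rat_dvd_resultant:
  assumes "Im \<tau> > 0"
  shows "min_poly_rat (rr_cf (2 * \<tau>)) dvd
    resultant (P2 Y X) (poly_in_Y (min_poly_rat (rr_cf \<tau>)))"
  using assms by (intro min_poly_rat_dvd poly_rat_resultant_P2[OF P2_rr_cf] rr_cf_nonzero min_poly_rat_root) auto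

section \<open>Norms of admissible elements\<close>

lemma cnj_of_rat [simp]: "cnj (of_rat r) = of_rat r"
  by (cases r) (simp add: of_rat_rat)

lemma cnj_sqrt_neg: "cnj (sqrt_neg D) = - sqrt_neg D"
  by (simp add: sqrt_neg_def)

lemma sqrt_neg_mult_self: "D > 0 \<Longrightarrow> sqrt_neg D * sqrt_neg D = - of_int D"
  by (simp add: sqrt_neg_def complex_eq_iff)

lemma imag_quad_field_norm_rat:
  assumes "D > 0" "z \<in> imag_quad_field D"
  shows "z * cnj z \<in> \<rat>"
proof -
  obtain a b where z: "z = of_rat a + of_rat b * sqrt_neg D"
    using assms(2) by (auto simp: imag_quad_field_def)
  have "z * cnj z = of_rat a * of_rat a - of_rat b * of_rat b * (sqrt_neg D * sqrt_neg D)"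
    unfolding z by (simp add: cnj_sqrt_neg algebra_simps)
  also have "\<dots> = of_rat (a * a + b * b * of_int D)"
    unfolding sqrt_neg_mult_self[OF assms(1)] by (simp add: of_rat_add of_rat_mult)
  finally show ?thesis by simp
qed

lemma imag_quad_field_cnj:
  assumes "z \<in> imag_quad_field D"
  shows "cnj z \<in> imag_quad_field D"
proof -
  obtain a b where "z = of_rat a + of_rat b * sqrt_neg D"
    using assms by (auto simp: imag_quad_field_def)
  then have "cnj z = of_rat a + of_rat (- b) * sqrt_neg D"
    by (simp add: cnj_sqrt_neg of_rat_minus)
  then show ?thesis unfolding imag_quad_field_def by blast
qed

lemma imag_quad_field_divide:
  assumes "z \<in> imag_quad_field D"
  shows "z / of_rat c \<in> imag_quad_field D"
proof -
  obtain a b where "z = of_rat a + of_rat b * sqrt_neg D"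
    using assms by (auto simp: imag_quad_field_def)
  then have "z / of_rat c = of_rat (a / c) + of_rat (b / c) * sqrt_neg D"
    by (simp add: of_rat_divide add_divide_distrib)
  then show ?thesis unfolding imag_quad_field_def by blast
qed

lemma of_int_in_ring_of_integers: "of_int k \<in> carrier (ring_of_integers D)"
proof -
  have "of_int k = of_rat (of_int k) + of_rat 0 * sqrt_neg D" by simp
  then have "of_int k \<in> imag_quad_field D" unfolding imag_quad_field_def by blast
  then show ?thesis by (simp add: ring_of_integers_def int_imp_algebraic_int)
qed

lemma algebraic_int_if_trace_norm_int:
  fixes z :: complex
  assumes "z + cnj z \<in> \<int>" "z * cnj z \<in> \<int>"
  shows "algebraic_int z"
proof (rule algebraic_int.intros)
  show "lead_coeff [:z * cnj z, - (z + cnj z), 1:] = 1" by simp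
  show "\<forall>i. Polynomial.coeff [:z * cnj z, - (z + cnj z), 1:] i \<in> \<int>"
    using assms Ints_minus[OF assms(1)] by (auto simp: coeff_pCons split: nat.splits)
  show "poly [:z * cnj z, - (z + cnj z), 1:] z = 0" by (simp add: algebra_simps)
qed

section \<open>Norms in the square of a prime ideal above 5\<close>

context
  fixes D :: int and P :: "complex set"
  assumes D: "D > 0" and P: "prime_ideal_above_5 D P"
begin

private abbreviation "R \<equiv> ring_of_integers D"

interpretation primeideal P R
  using P by (simp add: prime_ideal_above_5_def)

lemma ring_of_integers_simps:
  "x \<otimes>\<^bsub>R\<^esub> y = x * y" "x \<oplus>\<^bsub>R\<^esub> y = x + y" "\<one>\<^bsub>R\<^esub> = 1"
  by (simp_all add: ring_of_integers_def)

lemma ring_of_integers_closed: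
  assumes "x \<in> carrier R" "y \<in> carrier R"
  shows "x * y \<in> carrier R" "x + y \<in> carrier R"
  using m_closed[OF assms] a_closed[OF assms] by (simp_all add: ring_of_integers_simps)

lemma ring_of_integers_cnj: "x \<in> carrier R \<Longrightarrow> cnj x \<in> carrier R"
  by (auto simp: ring_of_integers_def imag_quad_field_cnj)

text \<open>Otherwise n is coprime to 5, and a Bezout relation puts 1 into P.\<close>

lemma prime_ideal_above_5_int:
  assumes "of_int n \<in> P"
  shows "5 dvd n"
proof (rule ccontr)
  assume "\<not> 5 dvd n"
  then have "Rings.coprime 5 n" by (intro prime_imp_coprime) auto
  then obtain a b where "a * 5 + b * n = 1"
    by (metis bezout_int coprime_imp_gcd_eq_1)
  then have "(1 :: complex) = of_int a * 5 + of_int b * of_int n"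
    by (metis of_int_1 of_int_add of_int_mult of_int_numeral)
  moreover have "5 \<in> P" using P by (simp add: prime_ideal_above_5_def)
  then have "of_int a * 5 + of_int b * of_int n \<in> P"
    using assms I_l_closed[OF _ of_int_in_ring_of_integers, of _ a]
      I_l_closed[OF _ of_int_in_ring_of_integers, of _ b]
      additive_subgroup.a_closed[OF additive_subgroup_axioms]
    by (simp add: ring_of_integers_simps)
  ultimately have "\<one>\<^bsub>R\<^esub> \<in> P" by (simp add: ring_of_integers_simps)
  then show False using one_imp_carrier I_notcarr by simp
qed

lemma norm_int:
  assumes "x \<in> carrier R"
  obtains n where "x * cnj x = of_int n"
proof -
  have "x * cnj x \<in> carrier R"
    using assms by (intro ring_of_integers_closed ring_of_integers_cnj)
  then have "algebraic_int (x * cnj x)" by (simp add: ring_of_integers_def)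
  moreover have "x * cnj x \<in> \<rat>"
    using imag_quad_field_norm_rat[OF D] assms by (simp add: ring_of_integers_def)
  ultimately show thesis using rational_algebraic_int_is_int that by (metis Ints_cases)
qed

lemma norm_prime_ideal_above_5:
  assumes "x \<in> P"
  obtains n where "x * cnj x = of_int (5 * n)"
proof -
  have x: "x \<in> carrier R" using assms a_subset by blast
  obtain m where m: "x * cnj x = of_int m" using norm_int[OF x] .
  have "x * cnj x \<in> P"
    using I_r_closed[OF assms ring_of_integers_cnj[OF x]] by (simp add: ring_of_integers_simps)
  then have "5 dvd m" using prime_ideal_above_5_int m by simp
  then show thesis using that m by (auto elim!: dvdE)
qed

text \<open>The quotient g is integral because its trace and norm are integers: by polarisation 5
  times the trace is N(x + y) - N(x) - N(y), and 25 times the norm is N(x) N(y), where 5 divides all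
  norms from P.\<close>

lemma mult_cnj_prime_ideal_above_5:
  assumes x: "x \<in> P" and y: "y \<in> P"
  obtains g where "g \<in> carrier R" "x * cnj y = 5 * g"
proof
  define g where "g = x * cnj y / 5"
  show "x * cnj y = 5 * g" by (simp add: g_def)
  have xy: "x + y \<in> P"
    using additive_subgroup.a_closed[OF additive_subgroup_axioms x y] by (simp add: ring_of_integers_simps)
  obtain k m n where k: "x * cnj x = of_int (5 * k)" and m: "y * cnj y = of_int (5 * m)"
    and n: "(x + y) * cnj (x + y) = of_int (5 * n)"
    using norm_prime_ideal_above_5[OF x] norm_prime_ideal_above_5[OF y]
      norm_prime_ideal_above_5[OF xy] by metis
  have "g + cnj g = ((x + y) * cnj (x + y) - x * cnj x - y * cnj y) / 5"
    by (simp add: g_def field_simps)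
  also have "\<dots> = of_int (n - k - m)" unfolding k m n by (simp add: field_simps)
  finally have "g + cnj g \<in> \<int>" by simp
  moreover have "g * cnj g = (x * cnj x) * (y * cnj y) / 25" by (simp add: g_def)
  then have "g * cnj g = of_int (k * m)" unfolding k m by simp
  then have "g * cnj g \<in> \<int>" by simp
  ultimately have "algebraic_int g" by (rule algebraic_int_if_trace_norm_int)
  moreover have "x * cnj y \<in> carrier R"
    using x y a_subset by (intro ring_of_integers_closed ring_of_integers_cnj) auto
  then have "x * cnj y / of_rat 5 \<in> imag_quad_field D"
    by (intro imag_quad_field_divide) (simp add: ring_of_integers_def)
  ultimately show "g \<in> carrier R" by (simp add: ring_of_integers_def g_def)
qed

text \<open>The norm is not additive, but \<open>w * cnj w'\<close> is additive in each argument, so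
  induction over the generation of the ideal product works in w and then in w'.\<close>

lemma mult_cnj_prime_ideal_above_5_square:
  assumes "w \<in> ideal_prod R P P" "w' \<in> ideal_prod R P P"
  shows "\<exists>g \<in> carrier R. w * cnj w' = 25 * g"
  using assms(1)
proof (induction w rule: ideal_prod.induct)
  case (prod x y)
  show ?case using assms(2)
  proof (induction w' rule: ideal_prod.induct)
    case (prod x' y')
    obtain g where g: "g \<in> carrier R" "x * cnj x' = 5 * g"
      using mult_cnj_prime_ideal_above_5[OF \<open>x \<in> P\<close> \<open>x' \<in> P\<close>] .
    obtain h where h: "h \<in> carrier R" "y * cnj y' = 5 * h"
      using mult_cnj_prime_ideal_above_5[OF \<open>y \<in> P\<close> \<open>y' \<in> P\<close>] .
    have "(x * y) * cnj (x' * y') = (x * cnj x') * (y * cnj y')" by simp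
    also have "\<dots> = 25 * (g * h)" unfolding g h by simp
    finally show ?case
      using ring_of_integers_closed(1)[OF g(1) h(1)] by (auto simp: ring_of_integers_simps)
  next
    case (sum s1 s2)
    then obtain g h where "g \<in> carrier R" "h \<in> carrier R"
      "(x \<otimes>\<^bsub>R\<^esub> y) * cnj s1 = 25 * g" "(x \<otimes>\<^bsub>R\<^esub> y) * cnj s2 = 25 * h" by blast
    then show ?case
      by (intro bexI[of _ "g + h"]) (simp_all add: ring_of_integers_closed ring_of_integers_simps algebra_simps)
  qed
next
  case (sum s1 s2)
  then obtain g h where "g \<in> carrier R" "h \<in> carrier R"
    "s1 * cnj w' = 25 * g" "s2 * cnj w' = 25 * h" by blast
  then show ?case
    by (intro bexI[of _ "g + h"]) (simp_all add: ring_of_integers_closed ring_of_integers_simps algebra_simps)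
qed

text \<open>The cofactor of 25 is both rational and an algebraic integer, hence an integer.\<close>

lemma norm_prime_ideal_above_5_square:
  assumes "w \<in> carrier R" "w \<in> ideal_prod R P P"
  obtains n where "w * cnj w = of_int (25 * n)"
proof -
  obtain g where g: "g \<in> carrier R" "w * cnj w = 25 * g"
    using mult_cnj_prime_ideal_above_5_square[OF assms(2) assms(2)] by blast
  obtain m where m: "w * cnj w = of_int m" using norm_int[OF assms(1)] .
  have "g = of_int m / of_int 25" using g m by simp
  then have "g \<in> \<rat>" by (metis Rats_divide Rats_of_int)
  then have "g \<in> \<int>" using rational_algebraic_int_is_int g(1) by (auto simp: ring_of_integers_def)
  then obtain n where "g = of_int n" by (rule Ints_cases)
  then show thesis using that g(2) by simp
qed

end

text \<open>v^2 + D is four times the norm of w, and this norm is divisible by 25.\<close>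

lemma admissible_w_dvd:
  assumes "D > 0" "admissible_w D w"
  obtains v :: int where "w = (of_int v + sqrt_neg D) / 2" "100 dvd v\<^sup>2 + D"
proof -
  obtain v P where v: "w = (of_int v + sqrt_neg D) / 2" and w: "w \<in> carrier (ring_of_integers D)"
    and P: "prime_ideal_above_5 D P" "w \<in> ideal_prod (ring_of_integers D) P P"
    using assms(2) unfolding admissible_w_def by blast
  obtain n where n: "w * cnj w = of_int (25 * n)"
    using norm_prime_ideal_above_5_square[OF assms(1) P(1) w P(2)] .
  have w2: "2 * w = of_int v + sqrt_neg D" "2 * cnj w = of_int v - sqrt_neg D"
    unfolding v by (simp_all add: cnj_sqrt_neg)
  have "4 * (w * cnj w) = (2 * w) * (2 * cnj w)" by simp
  also have "\<dots> = of_int v * of_int v - sqrt_neg D * sqrt_neg D"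
    unfolding w2 by (simp add: algebra_simps)
  also have "\<dots> = of_int (v\<^sup>2 + D)"
    unfolding sqrt_neg_mult_self[OF assms(1)] by (simp add: power2_eq_square)
  finally have "complex_of_int (v\<^sup>2 + D) = of_int (100 * n)"
    unfolding n by simp
  then have "v\<^sup>2 + D = 100 * n" by (simp only: of_int_eq_iff)
  then show thesis using that v by simp
qed

section \<open>Comparison of the admissible elements for d and 4d\<close>

lemma sqrt_neg_4: "sqrt_neg (4 * d) = 2 * sqrt_neg d"
  by (simp add: sqrt_neg_def real_sqrt_mult)

text \<open>If 5 divided both u - v and u + v it would divide 2v, hence v and d. So one factor is
  coprime to 25, and 25 divides the other.\<close>

lemma square_roots_mod_25:
  fixes u v d :: int
  assumes "\<not> 5 dvd d" "25 dvd u\<^sup>2 + d" "25 dvd v\<^sup>2 + d"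
  shows "25 dvd u - v \<or> 25 dvd u + v"
proof -
  have "25 dvd (u\<^sup>2 + d) - (v\<^sup>2 + d)" using assms by (intro dvd_diff)
  then have uv: "25 dvd (u - v) * (u + v)" by (simp add: algebra_simps power2_eq_square)
  have "\<not> 5 dvd v"
  proof
    assume "5 dvd v"
    moreover have "5 dvd v\<^sup>2 + d" using assms(3) by (rule dvd_trans[rotated]) simp
    ultimately show False using assms(1) by (simp add: power2_eq_square dvd_add_right_iff)
  qed
  then have "\<not> (5 dvd u - v \<and> 5 dvd u + v)" by presburger
  then have "Rings.coprime (5 ^ 2) (u - v) \<or> Rings.coprime (5 ^ 2) (u + v)"
    using prime_imp_coprime[of "5 :: int"] by (auto simp del: power_numeral)
  then show ?thesis using uv by (auto simp: coprime_dvd_mult_left_iff coprime_dvd_mult_right_iff)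
qed

theorem theorem5p2:
  fixes d :: int and p_d p_4d :: "rat poly"
  assumes "negative_discriminant (- d)"
    and "[- d = 1] (mod 5) \<or> [- d = - 1] (mod 5)"
    and "is_p d p_d"
    and "is_p (4 * d) p_4d"
  shows "p_4d dvd resultant (P2 Y X) (poly_in_Y p_d)"
proof -
  have d: "d > 0" using assms(1) by (simp add: negative_discriminant_def)
  have "\<not> 5 dvd d" using assms(2) by (auto simp: cong_def; presburger)
  obtain w w' where w: "admissible_w d w" "p_d = min_poly_rat (rr_cf (w / 5))"
    and w': "admissible_w (4 * d) w'" "p_4d = min_poly_rat (rr_cf (w' / 5))"
    using assms(3,4) unfolding is_p_def by blast
  obtain v where v: "w = (of_int v + sqrt_neg d) / 2" "100 dvd v\<^sup>2 + d"
    using admissible_w_dvd[OF d w(1)] .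
  obtain v' where v': "w' = (of_int v' + sqrt_neg (4 * d)) / 2" "100 dvd v'\<^sup>2 + 4 * d"
    using admissible_w_dvd[OF _ w'(1)] d by auto
  have "even (v'\<^sup>2 + 4 * d)" by (rule dvd_trans[OF _ v'(2)]) simp
  then obtain u where u: "v' = 2 * u" by (auto elim: evenE)
  have w'u: "w' = of_int u + sqrt_neg d" by (simp add: v'(1) u sqrt_neg_4)
  have "4 * 25 dvd 4 * (u\<^sup>2 + d)" using v'(2) by (simp add: u power_mult_distrib)
  then have "25 dvd u\<^sup>2 + d" by (subst (asm) dvd_mult_cancel_left) simp
  moreover have "25 dvd v\<^sup>2 + d" by (rule dvd_trans[OF _ v(2)]) simp
  ultimately have "25 dvd u - v \<or> 25 dvd u + v"
    using square_roots_mod_25[OF \<open>\<not> 5 dvd d\<close>] by blast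
  moreover have Im: "Im (w / 5) > 0" using d by (simp add: v sqrt_neg_def)
  \<comment> \<open>The witness is w / 5 if u = v modulo 25 and its reflection
    \<open>- cnj (w / 5)\<close> if u = -v. The multiple of 25 becomes a multiple of the period 5
    after division by 5.\<close>
  have "\<exists>\<tau>. Im \<tau> > 0 \<and> p_d = min_poly_rat (rr_cf \<tau>) \<and> rr_cf (w' / 5) = rr_cf (2 * \<tau>)"
    using calculation
  proof
    assume "25 dvd u - v"
    then obtain k where "u - v = 25 * k" by (auto elim: dvdE)
    then have "u = v + 25 * k" by simp
    then have "w' / 5 = 2 * (w / 5) + 5 * of_int k"
      unfolding w'u v(1) by (simp add: field_simps)
    then show ?thesis using Im w(2) rr_cf_shift by metis
  next
    assume "25 dvd u + v"
    then obtain k where "u + v = 25 * k" by (auto elim: dvdE)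
    then have u: "u = - v + 25 * k" by simp
    have "w' / 5 = 2 * (- cnj (w / 5)) + 5 * of_int k"
      unfolding w'u v(1) u by (simp add: field_simps cnj_sqrt_neg)
    then have "rr_cf (w' / 5) = rr_cf (2 * (- cnj (w / 5)))" using rr_cf_shift by metis
    moreover have "p_d = min_poly_rat (rr_cf (- cnj (w / 5)))"
      unfolding w(2) rr_cf_cnj[OF Im] min_poly_rat_cnj ..
    moreover have "Im (- cnj (w / 5)) > 0" using Im by simp
    ultimately show ?thesis by blast
  qed
  then obtain \<tau> where "Im \<tau> > 0" "p_d = min_poly_rat (rr_cf \<tau>)" "rr_cf (w' / 5) = rr_cf (2 * \<tau>)"
    by blast
  then show ?thesis using min_poly_rat_dvd_resultant[of \<tau>] w'(2) by simp
qed

end
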